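(* Let $\pi$ be a locally finite transition matrix over an at most countable set $V$. Then there exist a real closed non-Archimedean ordered field $\mathbb K$, a connected locally finite weighted graph $b$ over $V$ with values in $\mathbb K$ and a subset $U\subseteq V$ such that $\pi=\pi_U^b$ if and only if there is a function $\beta:V\to\mathbb R^+$ such that for every irreducible class $C$ of $\pi$ and all $x,y\in C$ $$\pi(x,y)\beta(x)=\pi(y,x)\beta(y),$$ and $\pi(x,x)=0$ for every $x\in V$ which is not an absorbing state. Furthermore, if $\pi=\pi_U^b$, then $\beta$ can be chosen such that for every irreducible class $C$ there is $a\in C$ with $\beta(a)=1$ and $\beta(x)=\rho\big(b(x)/b(a)\big)$ for all $x\in C$.
   Context: A transition matrix over $V$ is a map $\pi:V\times V\to[0,\infty)$ with $\sum_{y\in V}\pi(x,y)=1$ for all $x\in V$. It is viewed as a directed graph and is called locally finite if for every $x\in V$ the set $\{y\in V:\pi(x,y)\neq0\}$ is finite. Write $x\leadsto y$ if $\pi(x,y)\ne0$; $x\to y$ if $x=y$ or there are $x=x_0\leadsto x_1\leadsto\dots\leadsto x_n=y$; $x\leftrightarrow y$ if $x\to y$ and $y\to x$. Irreducible classes are the equivalence classes of $\leftrightarrow$. A state $x$ is absorbing if no state other than $x$ can be reached from $x$, i.e. $\pi(x,x)=1$. $\mathbb R^+=(0,\infty)$. An ordered field $(\mathbb K,\succ)$ is non-Archimedean if there is $\tau\succ0$ in $\mathbb K$ with $\tau\prec 1/n$ for all $n\in\mathbb N$, $n\geq 1$. $\mathbb K^+$ denotes the positive elements. Weighted graph over $V$: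 a symmetric map $b:V\times V\to\mathbb K^+\cup\{0\}$ with $b(x,x)=0$ for all $x$; $x\sim y$ means $b(x,y)\succ0$. Connected: any two vertices $x,y$ are joined by some $x=x_0\sim\dots\sim x_n=y$. Locally finite (for $b$): every vertex $x$ has finitely many $y$ with $y\sim x$. Put $b(x)=\sum_{y\in V}b(x,y)$ and $p(x,y)=b(x,y)/b(x)$ ($b(x)\succ0$ is automatic when $V$ has at least two elements). Real part: for $k\in\mathbb K$ with $|k|\prec c$ for some positive rational $c$, $\rho(k)$ is the unique real number such that $|k-\rho(k)|$ is smaller than every positive rational in an ordered field containing $\mathbb K$ and $\mathbb R$. For $U\subseteq V$, the real transition matrix $\pi_U^b$ is given by $\pi_U^b(x,y)=\rho(p(x,y))$ if $x\in U$; $\pi_U^b(x,x)=1$ if $x\in V\setminus U$; $\pi_U^b(x,y)=0$ if $x\in V\setminus U$ and $x\neq y$.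
   Formalization: The "if" direction also assumes that each state y has only finitely many x with π(x,y)≠0 (it is false otherwise, e.g. π(n,0)=1 on ℕ); the formula β(x)=ρ(b(x)/b(a)) is not claimed when V has only one point, where b(a)=0. *)

theory Defs
  imports
    "HOL-Algebra.Polynomials"
    "HOL-Analysis.Infinite_Sum"
begin

section \<open>Ordered fields\<close>

text \<open>
  The field is existentially quantified in the theorem, so it has to be an object of the logic
  rather than an instance of a type class: a ring record extended by a strict order.
\<close>

record 'a ordered_ring = "'a ring" +
  lt :: "'a \<Rightarrow> 'a \<Rightarrow> bool"  (infixl \<open>\<prec>\<index>\<close> 50)

locale ordered_field = field K for K :: "('a, 'm) ordered_ring_scheme" (structure) +
  assumes lt_irrefl: "a \<in> carrier K \<Longrightarrow> \<not> a \<prec> a"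
    and lt_trans: "\<lbrakk>a \<in> carrier K; b \<in> carrier K; c \<in> carrier K; a \<prec> b; b \<prec> c\<rbrakk> \<Longrightarrow> a \<prec> c"
    and lt_total: "\<lbrakk>a \<in> carrier K; b \<in> carrier K; a \<noteq> b\<rbrakk> \<Longrightarrow> a \<prec> b \<or> b \<prec> a"
    and lt_add: "\<lbrakk>a \<in> carrier K; b \<in> carrier K; c \<in> carrier K; a \<prec> b\<rbrakk> \<Longrightarrow> a \<oplus> c \<prec> b \<oplus> c"
    and lt_mult: "\<lbrakk>a \<in> carrier K; b \<in> carrier K; \<zero> \<prec> a; \<zero> \<prec> b\<rbrakk> \<Longrightarrow> \<zero> \<prec> a \<otimes> b"

definition fdiv :: "('a, 'm) ordered_ring_scheme \<Rightarrow> 'a \<Rightarrow> 'a \<Rightarrow> 'a"  (infixl \<open>\<oslash>\<index>\<close> 70)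
  where "a \<oslash>\<^bsub>K\<^esub> b = a \<otimes>\<^bsub>K\<^esub> inv\<^bsub>K\<^esub> b"

definition fabs :: "('a, 'm) ordered_ring_scheme \<Rightarrow> 'a \<Rightarrow> 'a"
  where "fabs K a = (if a \<prec>\<^bsub>K\<^esub> \<zero>\<^bsub>K\<^esub> then \<ominus>\<^bsub>K\<^esub> a else a)"

definition nonneg :: "('a, 'm) ordered_ring_scheme \<Rightarrow> 'a \<Rightarrow> bool"
  where "nonneg K a \<longleftrightarrow> a = \<zero>\<^bsub>K\<^esub> \<or> \<zero>\<^bsub>K\<^esub> \<prec>\<^bsub>K\<^esub> a"

text \<open>Real closedness in the sense of Artin and Schreier.\<close>

definition real_closed_field :: "('a, 'm) ordered_ring_scheme \<Rightarrow> bool"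
  where "real_closed_field K \<longleftrightarrow>
    ordered_field K \<and>
    (\<forall>a\<in>carrier K. \<zero>\<^bsub>K\<^esub> \<prec>\<^bsub>K\<^esub> a \<longrightarrow> (\<exists>s\<in>carrier K. s \<otimes>\<^bsub>K\<^esub> s = a)) \<and>
    (\<forall>p\<in>carrier (univ_poly K (carrier K)). odd (degree p) \<longrightarrow> (\<exists>s\<in>carrier K. ring.eval K p s = \<zero>\<^bsub>K\<^esub>))"

definition non_archimedean :: "('a, 'm) ordered_ring_scheme \<Rightarrow> bool"
  where "non_archimedean K \<longleftrightarrow>
    (\<exists>\<tau>\<in>carrier K. \<zero>\<^bsub>K\<^esub> \<prec>\<^bsub>K\<^esub> \<tau> \<and>
       (\<forall>n::nat. n \<ge> 1 \<longrightarrow> \<tau> \<prec>\<^bsub>K\<^esub> \<one>\<^bsub>K\<^esub> \<oslash>\<^bsub>K\<^esub> ([n] \<cdot>\<^bsub>K\<^esub> \<one>\<^bsub>K\<^esub>)))"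

definition rat_elem :: "('a, 'm) ordered_ring_scheme \<Rightarrow> rat \<Rightarrow> 'a"
  where "rat_elem K q =
    ([fst (quotient_of q)] \<cdot>\<^bsub>K\<^esub> \<one>\<^bsub>K\<^esub>) \<oslash>\<^bsub>K\<^esub> ([snd (quotient_of q)] \<cdot>\<^bsub>K\<^esub> \<one>\<^bsub>K\<^esub>)"

definition bounded_elem :: "('a, 'm) ordered_ring_scheme \<Rightarrow> 'a \<Rightarrow> bool"
  where "bounded_elem K k \<longleftrightarrow> (\<exists>c::rat. c > 0 \<and> fabs K k \<prec>\<^bsub>K\<^esub> rat_elem K c)"

text \<open>
  The element \<open>k\<close> and the real number \<open>r\<close> live in different fields, so that they differ by less
  than every positive rational is expressed inside the common subfield of rationals:
  every rational below (above) \<open>r\<close> is below (above) \<open>k\<close>.  Lemma \<open>is_real_part_iff\<close> below shows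
  that this is the same as \<open>\<bar>k - r\<bar>\<close> being smaller than every positive rational in any
  ordered field that contains both fields.
\<close>

definition is_real_part :: "('a, 'm) ordered_ring_scheme \<Rightarrow> 'a \<Rightarrow> real \<Rightarrow> bool"
  where "is_real_part K k r \<longleftrightarrow>
    (\<forall>q::rat. (real_of_rat q < r \<longrightarrow> rat_elem K q \<prec>\<^bsub>K\<^esub> k) \<and>
              (r < real_of_rat q \<longrightarrow> k \<prec>\<^bsub>K\<^esub> rat_elem K q))"

definition real_part :: "('a, 'm) ordered_ring_scheme \<Rightarrow> 'a \<Rightarrow> real"
  where "real_part K k = (THE r. is_real_part K k r)"

context ordered_field
begin

abbreviation int_elem :: "int \<Rightarrow> 'a" where "int_elem n \<equiv> [n] \<cdot> \<one>"

lemma int_elem_closed: "int_elem n \<in> carrier K"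
  by simp

lemma int_elem_zero: "int_elem 0 = \<zero>"
  by (simp add: add_pow_int_ge)

lemma int_elem_add: "int_elem (m + n) = int_elem m \<oplus> int_elem n"
  using add.int_pow_mult[of \<one> m n] by simp

lemma int_elem_mult: "int_elem (m * n) = int_elem m \<otimes> int_elem n"
  using add.int_pow_pow[of \<one> m n] add_pow_ldistr_int[of \<one> "int_elem n" m]
  by (simp add: mult.commute)

lemma zero_lt_one: "\<zero> \<prec> \<one>"
proof (rule ccontr)
  assume "\<not> \<zero> \<prec> \<one>"
  then have "\<one> \<prec> \<zero>"
    using lt_total[of \<zero> \<one>] by auto
  then have "\<zero> \<prec> \<ominus> \<one>"
    using lt_add[of \<one> \<zero> "\<ominus> \<one>"] by (simp add: r_neg)
  then have "\<zero> \<prec> \<ominus> \<one> \<otimes> \<ominus> \<one>"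
    by (intro lt_mult) auto
  then have "\<zero> \<prec> \<one>"
    by (simp add: l_minus r_minus)
  with \<open>\<not> \<zero> \<prec> \<one>\<close> show False ..
qed

lemma int_elem_pos: "n > 0 \<Longrightarrow> \<zero> \<prec> int_elem n"
proof (induction n rule: int_gr_induct)
  case base
  then show ?case using zero_lt_one by simp
next
  case (step n)
  have "\<zero> \<oplus> \<one> \<prec> int_elem n \<oplus> \<one>"
    using step by (intro lt_add) auto
  then have "\<one> \<prec> int_elem (n + 1)"
    by (simp add: int_elem_add)
  then show ?case
    using lt_trans[OF _ _ _ zero_lt_one] by auto
qed

lemma lt_iff_diff: "\<lbrakk>a \<in> carrier K; b \<in> carrier K\<rbrakk> \<Longrightarrow> a \<prec> b \<longleftrightarrow> \<zero> \<prec> b \<ominus> a"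
  using lt_add[of a b "\<ominus> a"] lt_add[of \<zero> "b \<ominus> a" a]
  by (auto simp: r_neg a_minus_def a_assoc l_neg)

lemma lt_mult_right:
  assumes "a \<in> carrier K" "b \<in> carrier K" "c \<in> carrier K" "a \<prec> b" "\<zero> \<prec> c"
  shows "a \<otimes> c \<prec> b \<otimes> c"
proof -
  have "\<zero> \<prec> (b \<ominus> a) \<otimes> c"
    using assms lt_iff_diff[of a b] by (intro lt_mult) auto
  then show ?thesis
    using assms lt_iff_diff[of "a \<otimes> c" "b \<otimes> c"] by (simp add: a_minus_def l_distr l_minus)
qed

lemma int_elem_mono:
  assumes "m < n" shows "int_elem m \<prec> int_elem n"
proof -
  have "\<zero> \<oplus> int_elem m \<prec> int_elem (n - m) \<oplus> int_elem m"
    using assms by (intro lt_add int_elem_pos) auto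
  then show ?thesis
    by (simp flip: int_elem_add)
qed

lemma int_elem_nonzero: "n > 0 \<Longrightarrow> int_elem n \<noteq> \<zero>"
  using int_elem_pos[of n] lt_irrefl[of \<zero>] by auto

lemma rat_elem_closed: "rat_elem K q \<in> carrier K"
  using int_elem_nonzero[OF quotient_of_denom_pos', of q]
  by (simp add: rat_elem_def fdiv_def field_Units)

lemma rat_elem_zero: "rat_elem K 0 = \<zero>"
  using int_elem_nonzero[of 1] by (simp add: rat_elem_def fdiv_def int_elem_zero)

lemma rat_elem_mult_denom:
  "rat_elem K q \<otimes> int_elem (snd (quotient_of q)) = int_elem (fst (quotient_of q))"
  using int_elem_nonzero[OF quotient_of_denom_pos', of q]
  by (simp add: rat_elem_def fdiv_def field_Units m_assoc)

lemma rat_elem_mono: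
  assumes "p < q" shows "rat_elem K p \<prec> rat_elem K q"
proof (rule ccontr)
  define a b c d where "a = fst (quotient_of p)" "b = snd (quotient_of p)"
    "c = fst (quotient_of q)" "d = snd (quotient_of q)"
  note defs = this
  have pos: "b > 0" "d > 0"
    using quotient_of_denom_pos' by (auto simp: defs)
  have eq: "rat_elem K p \<otimes> int_elem b = int_elem a" "rat_elem K q \<otimes> int_elem d = int_elem c"
    using rat_elem_mult_denom by (auto simp: defs)
  have "p = of_int a / of_int b" "q = of_int c / of_int d"
    by (auto simp: defs quotient_of_div)
  then have "of_int a / of_int b < (of_int c / of_int d :: rat)"
    using assms by simp
  then have "of_int (a * d) < (of_int (c * b) :: rat)"
    using pos by (simp add: field_simps)
  then have less: "int_elem (a * d) \<prec> int_elem (c * b)"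
    by (intro int_elem_mono) linarith
  have [simp]: "rat_elem K p \<in> carrier K" "rat_elem K q \<in> carrier K"
    by (rule rat_elem_closed)+
  have e1: "rat_elem K p \<otimes> int_elem (b * d) = int_elem (a * d)"
    by (simp add: int_elem_mult eq flip: m_assoc)
  have e2: "rat_elem K q \<otimes> int_elem (b * d) = int_elem (c * b)"
    by (subst mult.commute[of b]) (simp add: int_elem_mult eq flip: m_assoc)
  assume "\<not> rat_elem K p \<prec> rat_elem K q"
  then have "rat_elem K q \<prec> rat_elem K p \<or> rat_elem K p = rat_elem K q"
    using lt_total[of "rat_elem K p" "rat_elem K q"] by auto
  then have "int_elem (c * b) \<prec> int_elem (a * d) \<or> int_elem (a * d) = int_elem (c * b)"
    using lt_mult_right[of "rat_elem K q" "rat_elem K p" "int_elem (b * d)"]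
      int_elem_pos[of "b * d"] pos e1 e2 by auto
  then show False
    using less lt_irrefl[of "int_elem (a * d)"]
      lt_trans[of "int_elem (a * d)" "int_elem (c * b)" "int_elem (a * d)"] by auto
qed

lemma rat_elem_uminus: "rat_elem K (- q) = \<ominus> rat_elem K q"
proof -
  have "int_elem (- n) = \<ominus> int_elem n" for n
    using add.int_pow_neg[of \<one> n] by simp
  then show ?thesis
    using int_elem_nonzero[OF quotient_of_denom_pos', of q]
    by (simp add: rat_elem_def fdiv_def rat_uminus_code Let_def case_prod_beta field_Units l_minus)
qed

lemma ex1_real_part:
  assumes k: "k \<in> carrier K" and "bounded_elem K k"
  shows "\<exists>!r. is_real_part K k r"
proof -
  note rc = rat_elem_closed
  obtain c where c: "c > 0" "fabs K k \<prec> rat_elem K c"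
    using assms by (auto simp: bounded_elem_def)
  have "\<zero> \<prec> rat_elem K c"
    using rat_elem_mono[OF c(1)] by (simp add: rat_elem_zero)
  have up: "k \<prec> rat_elem K c"
    using c(2) \<open>\<zero> \<prec> rat_elem K c\<close> k lt_trans[of k \<zero> "rat_elem K c"] rc
    by (auto simp: fabs_def split: if_splits)
  have neg: "\<ominus> b \<prec> \<ominus> a" if "a \<in> carrier K" "b \<in> carrier K" "a \<prec> b" for a b
    using that lt_iff_diff[of a b] lt_iff_diff[of "\<ominus> b" "\<ominus> a"]
    by (simp add: a_minus_def a_comm)
  have low: "rat_elem K (- c) \<prec> k"
  proof (cases "k \<prec> \<zero>")
    case True
    then show ?thesis
      using neg[of "\<ominus> k" "rat_elem K c"] c(2) k rc by (simp add: fabs_def rat_elem_uminus)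
  next
    case False
    have "rat_elem K (- c) \<prec> \<zero>"
      using neg[OF _ _ \<open>\<zero> \<prec> rat_elem K c\<close>] rc by (simp add: rat_elem_uminus)
    then show ?thesis
      using False lt_total[of k \<zero>] lt_trans[of "rat_elem K (- c)" \<zero> k] k rc by auto
  qed
  define S where "S = {real_of_rat q | q. rat_elem K q \<prec> k}"
  have S: "q < q'" if "rat_elem K q \<prec> k" "\<not> rat_elem K q' \<prec> k" for q q'
    using that rat_elem_mono[of q' q] lt_trans[of "rat_elem K q'" "rat_elem K q" k] k rc
    by (cases q q' rule: linorder_cases) auto
  have nlow: "\<not> rat_elem K c \<prec> k"
    using up lt_trans[of k "rat_elem K c" k] lt_irrefl[of k] k rc by auto
  have ne: "S \<noteq> {}" and bdd: "bdd_above S"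
    using low S[OF _ nlow]
    by (auto simp: S_def of_rat_less intro!: bdd_aboveI[of _ "real_of_rat c"] less_imp_le)
  have "is_real_part K k (Sup S)"
    unfolding is_real_part_def
  proof (intro allI conjI impI)
    fix q assume "real_of_rat q < Sup S"
    then obtain q' where "rat_elem K q' \<prec> k" "q < q'"
      using less_cSup_iff[OF ne bdd] by (auto simp: S_def of_rat_less)
    then show "rat_elem K q \<prec> k"
      using rat_elem_mono[of q q'] lt_trans[of "rat_elem K q" "rat_elem K q'" k] k rc by auto
  next
    fix q assume "Sup S < real_of_rat q"
    then obtain q' where q': "Sup S < real_of_rat q'" "real_of_rat q' < real_of_rat q"
      using of_rat_dense by blast
    then have "\<not> rat_elem K q' \<prec> k"
      using cSup_upper[OF _ bdd, of "real_of_rat q'"] by (auto simp: S_def)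
    then have "k \<prec> rat_elem K q' \<or> k = rat_elem K q'"
      using lt_total[OF k rc, of q'] by auto
    then show "k \<prec> rat_elem K q"
      using rat_elem_mono[of q' q] q'(2) lt_trans[of k "rat_elem K q'" "rat_elem K q"] k rc
      by (auto simp: of_rat_less)
  qed
  moreover have "r = s" if "is_real_part K k r" "is_real_part K k s" for r s
  proof -
    have "\<not> r < s" if "is_real_part K k r" "is_real_part K k s" for r s
    proof
      assume "r < s"
      then obtain q where "r < real_of_rat q" "real_of_rat q < s"
        using of_rat_dense by blast
      then have "k \<prec> rat_elem K q" "rat_elem K q \<prec> k"
        using that by (auto simp: is_real_part_def)
      then show False
        using lt_trans[of k "rat_elem K q" k] lt_irrefl[of k] k rc by auto
    qed
    from this[of r s] this[of s r] that show ?thesis by auto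
  qed
  ultimately show ?thesis by blast
qed

lemma is_real_part_iff:
  fixes i :: "'a \<Rightarrow> 'l::linordered_field" and j :: "real \<Rightarrow> 'l"
  assumes i: "i \<one> = 1"
      "\<And>a b. \<lbrakk>a \<in> carrier K; b \<in> carrier K\<rbrakk> \<Longrightarrow> i (a \<oplus> b) = i a + i b"
      "\<And>a b. \<lbrakk>a \<in> carrier K; b \<in> carrier K\<rbrakk> \<Longrightarrow> i (a \<otimes> b) = i a * i b"
      "\<And>a b. \<lbrakk>a \<in> carrier K; b \<in> carrier K; a \<prec> b\<rbrakk> \<Longrightarrow> i a < i b"
    and j: "j 1 = 1" "\<And>a b. j (a + b) = j a + j b" "\<And>a b. j (a * b) = j a * j b"
      "\<And>a b. a < b \<Longrightarrow> j a < j b"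
    and k: "k \<in> carrier K"
  shows "is_real_part K k r \<longleftrightarrow> (\<forall>\<epsilon>::rat. \<epsilon> > 0 \<longrightarrow> \<bar>i k - j r\<bar> < of_rat \<epsilon>)"
proof -
  have i0: "i \<zero> = 0"
    using i(2)[of \<zero> \<zero>] by simp
  have i_int: "i (int_elem n) = of_int n" for n
  proof (induction n rule: int_induct[where k = 0])
    case base
    then show ?case by (simp add: i0 int_elem_zero)
  next
    case (step1 n)
    then show ?case by (simp add: int_elem_add i)
  next
    case (step2 n)
    have "i (int_elem n) = i (int_elem (n - 1)) + 1"
      using int_elem_add[of "n - 1" 1] by (simp add: i)
    with step2 show ?case by simp
  qed
  have i_rat: "i (rat_elem K q) = of_rat q" for q
  proof -
    have "i (rat_elem K q) * of_int (snd (quotient_of q)) = of_int (fst (quotient_of q))"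
      using arg_cong[OF rat_elem_mult_denom[of q], of i] by (simp add: i i_int rat_elem_closed)
    moreover have "of_rat q * of_int (snd (quotient_of q)) = (of_int (fst (quotient_of q)) :: 'l)"
    proof -
      have "q * of_int (snd (quotient_of q)) = of_int (fst (quotient_of q))"
        using quotient_of_div[of q "fst (quotient_of q)" "snd (quotient_of q)"]
          quotient_of_denom_pos'[of q]
        by (metis less_irrefl nonzero_eq_divide_eq of_int_eq_0_iff prod.collapse)
      from arg_cong[OF this, of "of_rat :: rat \<Rightarrow> 'l"] show ?thesis
        by (simp add: of_rat_mult)
    qed
    ultimately show ?thesis
      using quotient_of_denom_pos'[of q]
      by (metis less_irrefl mult_right_cancel of_int_eq_0_iff)
  qed
  have j0: "j 0 = 0"
    using j(2)[of 0 0] by simp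
  have j_int: "j (of_int n) = of_int n" for n
  proof (induction n rule: int_induct[where k = 0])
    case base
    then show ?case by (simp add: j0)
  next
    case (step1 n)
    then show ?case by (simp add: j)
  next
    case (step2 n)
    then show ?case using j(2)[of "of_int (n - 1)" 1] by (simp add: j(1))
  qed
  have j_rat: "j (of_rat q) = of_rat q" for q
  proof -
    obtain m n where q: "q = of_int m / of_int n" "n > 0"
      using quotient_of_div[of q] quotient_of_denom_pos[of q] by (cases "quotient_of q") auto
    have "j (real_of_rat q) * of_int n = of_int m"
      using q j(3)[of "real_of_rat q" "of_int n"] by (simp add: j_int of_rat_divide)
    then have "j (real_of_rat q) = of_int m / of_int n"
      using \<open>n > 0\<close> by (simp add: eq_divide_eq)
    also have "\<dots> = of_rat q"
      by (simp add: q(1) of_rat_divide)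
    finally show ?thesis .
  qed
  have i_less: "i a < i b \<longleftrightarrow> a \<prec> b" if "a \<in> carrier K" "b \<in> carrier K" for a b
    using i(4)[of a b] i(4)[of b a] lt_total[of a b] that by force
  have j_less: "j a < j b \<longleftrightarrow> a < b" for a b
    using j(4)[of a b] j(4)[of b a] by (cases a b rule: linorder_cases) auto
  have *: "is_real_part K k r \<longleftrightarrow>
    (\<forall>q. (of_rat q < j r \<longrightarrow> of_rat q < i k) \<and> (j r < of_rat q \<longrightarrow> i k < of_rat q))"
    unfolding is_real_part_def
    by (simp add: k rat_elem_closed flip: i_less j_less) (simp add: i_rat j_rat)
  show ?thesis
  proof
    assume part: "is_real_part K k r"
    show "\<forall>\<epsilon>::rat. \<epsilon> > 0 \<longrightarrow> \<bar>i k - j r\<bar> < of_rat \<epsilon>"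
    proof (intro allI impI)
      fix \<epsilon> :: rat assume "\<epsilon> > 0"
      then obtain p where p: "r - of_rat \<epsilon> < of_rat p" "of_rat p < r"
        using of_rat_dense[of "r - of_rat \<epsilon>" r] by auto
      obtain q where q: "r < of_rat q" "of_rat q < r + of_rat \<epsilon>"
        using of_rat_dense[of r "r + of_rat \<epsilon>"] \<open>\<epsilon> > 0\<close> by auto
      have "j r < j (of_rat (p + \<epsilon>))" "j (of_rat (q - \<epsilon>)) < j r" "j (of_rat p) < j r" "j r < j (of_rat q)"
        using p q by (auto simp: j_less of_rat_add of_rat_diff)
      then have "j r < of_rat p + of_rat \<epsilon>" "of_rat q - of_rat \<epsilon> < j r" "of_rat p < i k" "i k < of_rat q"
        using part unfolding * j_rat by (auto simp: of_rat_add of_rat_diff)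
      then show "\<bar>i k - j r\<bar> < of_rat \<epsilon>"
        by (auto simp: abs_less_iff algebra_simps dest: less_trans add_strict_mono)
    qed
  next
    assume close: "\<forall>\<epsilon>::rat. \<epsilon> > 0 \<longrightarrow> \<bar>i k - j r\<bar> < of_rat \<epsilon>"
    show "is_real_part K k r"
      unfolding *
    proof (intro allI conjI impI)
      fix q assume "of_rat q < j r"
      then have "of_rat q < r"
        by (simp flip: j_rat add: j_less)
      then obtain q' where q': "real_of_rat q < of_rat q'" "of_rat q' < r"
        using of_rat_dense by blast
      then have "\<bar>i k - j r\<bar> < of_rat (q' - q)" "of_rat q' < j r"
        using close by (auto simp: of_rat_less j_less simp flip: j_rat)
      then show "of_rat q < i k"
        by (simp add: of_rat_diff abs_less_iff)
    next
      fix q assume "j r < of_rat q"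
      then have "r < of_rat q"
        by (simp flip: j_rat add: j_less)
      then obtain q' where q': "r < of_rat q'" "real_of_rat q' < of_rat q"
        using of_rat_dense by blast
      then have "\<bar>i k - j r\<bar> < of_rat (q - q')" "j r < of_rat q'"
        using close by (auto simp: of_rat_less j_less simp flip: j_rat)
      then show "i k < of_rat q"
        by (simp add: of_rat_diff abs_less_iff)
    qed
  qed
qed

end


section \<open>Transition matrices\<close>

definition transition_matrix :: "'v set \<Rightarrow> ('v \<Rightarrow> 'v \<Rightarrow> real) \<Rightarrow> bool"
  where "transition_matrix V \<pi> \<longleftrightarrow>
    (\<forall>x\<in>V. \<forall>y\<in>V. 0 \<le> \<pi> x y) \<and> (\<forall>x\<in>V. (\<pi> x has_sum 1) V)"

definition locally_finite_matrix :: "'v set \<Rightarrow> ('v \<Rightarrow> 'v \<Rightarrow> real) \<Rightarrow> bool"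
  where "locally_finite_matrix V \<pi> \<longleftrightarrow> (\<forall>x\<in>V. finite {y\<in>V. \<pi> x y \<noteq> 0})"

text \<open>
  If \<open>\<pi>\<close> comes from a locally finite weighted graph, then this holds as well: a state \<open>y \<noteq> x\<close>
  with \<open>\<pi> y x \<noteq> 0\<close> is a neighbour of \<open>x\<close> in the weighted graph.  It does not follow from
  \<^const>\<open>locally_finite_matrix\<close>, nor from the conditions on \<open>\<beta>\<close>: consider \<open>\<pi> n 0 = 1\<close> on the
  natural numbers.
\<close>

definition finite_in_degree :: "'v set \<Rightarrow> ('v \<Rightarrow> 'v \<Rightarrow> real) \<Rightarrow> bool"
  where "finite_in_degree V \<pi> \<longleftrightarrow> (\<forall>x\<in>V. finite {y\<in>V. \<pi> y x \<noteq> 0})"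

definition reach :: "'v set \<Rightarrow> ('v \<Rightarrow> 'v \<Rightarrow> real) \<Rightarrow> ('v \<times> 'v) set"
  where "reach V \<pi> = {(x, y). x \<in> V \<and> y \<in> V \<and> \<pi> x y \<noteq> 0}\<^sup>*"

definition communicates :: "'v set \<Rightarrow> ('v \<Rightarrow> 'v \<Rightarrow> real) \<Rightarrow> ('v \<times> 'v) set"
  where "communicates V \<pi> =
    {(x, y). x \<in> V \<and> y \<in> V \<and> (x, y) \<in> reach V \<pi> \<and> (y, x) \<in> reach V \<pi>}"

definition irreducible_classes :: "'v set \<Rightarrow> ('v \<Rightarrow> 'v \<Rightarrow> real) \<Rightarrow> 'v set set"
  where "irreducible_classes V \<pi> = V // communicates V \<pi>"

definition absorbing :: "'v set \<Rightarrow> ('v \<Rightarrow> 'v \<Rightarrow> real) \<Rightarrow> 'v \<Rightarrow> bool"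
  where "absorbing V \<pi> x \<longleftrightarrow> (\<forall>y\<in>V. (x, y) \<in> reach V \<pi> \<longrightarrow> y = x)"

definition balanced_on_classes :: "'v set \<Rightarrow> ('v \<Rightarrow> 'v \<Rightarrow> real) \<Rightarrow> ('v \<Rightarrow> real) \<Rightarrow> bool"
  where "balanced_on_classes V \<pi> \<beta> \<longleftrightarrow>
    (\<forall>x\<in>V. \<beta> x > 0) \<and>
    (\<forall>C\<in>irreducible_classes V \<pi>. \<forall>x\<in>C. \<forall>y\<in>C. \<pi> x y * \<beta> x = \<pi> y x * \<beta> y)"


section \<open>Weighted graphs over an ordered field\<close>

definition weighted_graph ::
    "('k, 'm) ordered_ring_scheme \<Rightarrow> 'v set \<Rightarrow> ('v \<Rightarrow> 'v \<Rightarrow> 'k) \<Rightarrow> bool"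
  where "weighted_graph K V b \<longleftrightarrow>
    (\<forall>x\<in>V. \<forall>y\<in>V. b x y \<in> carrier K \<and> nonneg K (b x y) \<and> b x y = b y x) \<and>
    (\<forall>x\<in>V. b x x = \<zero>\<^bsub>K\<^esub>)"

definition adjacency :: "('k, 'm) ordered_ring_scheme \<Rightarrow> 'v set \<Rightarrow> ('v \<Rightarrow> 'v \<Rightarrow> 'k) \<Rightarrow> ('v \<times> 'v) set"
  where "adjacency K V b = {(x, y). x \<in> V \<and> y \<in> V \<and> \<zero>\<^bsub>K\<^esub> \<prec>\<^bsub>K\<^esub> b x y}"

definition connected_graph ::
    "('k, 'm) ordered_ring_scheme \<Rightarrow> 'v set \<Rightarrow> ('v \<Rightarrow> 'v \<Rightarrow> 'k) \<Rightarrow> bool"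
  where "connected_graph K V b \<longleftrightarrow> (\<forall>x\<in>V. \<forall>y\<in>V. (x, y) \<in> (adjacency K V b)\<^sup>*)"

definition locally_finite_graph ::
    "('k, 'm) ordered_ring_scheme \<Rightarrow> 'v set \<Rightarrow> ('v \<Rightarrow> 'v \<Rightarrow> 'k) \<Rightarrow> bool"
  where "locally_finite_graph K V b \<longleftrightarrow> (\<forall>x\<in>V. finite {y. (y, x) \<in> adjacency K V b})"

text \<open>The sum over \<open>V\<close> is taken over the support, because \<^const>\<open>finsum\<close> over an infinite set is
  not meaningful.\<close>

definition vweight ::
    "('k, 'm) ordered_ring_scheme \<Rightarrow> 'v set \<Rightarrow> ('v \<Rightarrow> 'v \<Rightarrow> 'k) \<Rightarrow> 'v \<Rightarrow> 'k"
  where "vweight K V b x = finsum K (b x) {y\<in>V. b x y \<noteq> \<zero>\<^bsub>K\<^esub>}"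

definition trans_prob ::
    "('k, 'm) ordered_ring_scheme \<Rightarrow> 'v set \<Rightarrow> ('v \<Rightarrow> 'v \<Rightarrow> 'k) \<Rightarrow> 'v \<Rightarrow> 'v \<Rightarrow> 'k"
  where "trans_prob K V b x y = b x y \<oslash>\<^bsub>K\<^esub> vweight K V b x"

definition real_matrix ::
    "('k, 'm) ordered_ring_scheme \<Rightarrow> 'v set \<Rightarrow> 'v set \<Rightarrow> ('v \<Rightarrow> 'v \<Rightarrow> 'k) \<Rightarrow> 'v \<Rightarrow> 'v \<Rightarrow> real"
  where "real_matrix K V U b x y =
    (if x \<in> U then real_part K (trans_prob K V b x y) else if x = y then 1 else 0)"

definition represents ::
    "('k, 'm) ordered_ring_scheme \<Rightarrow> 'v set \<Rightarrow> 'v set \<Rightarrow> ('v \<Rightarrow> 'v \<Rightarrow> 'k) \<Rightarrow> ('v \<Rightarrow> 'v \<Rightarrow> real) \<Rightarrow> bool"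
  where "represents K V U b \<pi> \<longleftrightarrow>
    real_closed_field K \<and> non_archimedean K \<and>
    weighted_graph K V b \<and> connected_graph K V b \<and> locally_finite_graph K V b \<and>
    U \<subseteq> V \<and> (\<forall>x\<in>V. \<forall>y\<in>V. \<pi> x y = real_matrix K V U b x y)"

text \<open>
  On a one-point graph the vertex weight is zero and \<open>b(x)/b(a)\<close> is undefined; this is the only
  reason for the guard \<open>V \<noteq> {a}\<close>.  Boundedness of the quotient says that its real part is
  defined, since \<^const>\<open>real_part\<close> is arbitrary otherwise.
\<close>

definition normalised_by_weights ::
    "('k, 'm) ordered_ring_scheme \<Rightarrow> 'v set \<Rightarrow> ('v \<Rightarrow> 'v \<Rightarrow> 'k) \<Rightarrow> ('v \<Rightarrow> 'v \<Rightarrow> real) \<Rightarrow> ('v \<Rightarrow> real) \<Rightarrow> bool"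
  where "normalised_by_weights K V b \<pi> \<beta> \<longleftrightarrow>
    (\<forall>C\<in>irreducible_classes V \<pi>. \<exists>a\<in>C. \<beta> a = 1 \<and>
      (V \<noteq> {a} \<longrightarrow>
        (\<forall>x\<in>C. bounded_elem K (vweight K V b x \<oslash>\<^bsub>K\<^esub> vweight K V b a) \<and>
               \<beta> x = real_part K (vweight K V b x \<oslash>\<^bsub>K\<^esub> vweight K V b a))))"

end

theory Submission
  imports Defs
begin

text \<open>
  If \<open>\<pi>(x,y) \<noteq> 0\<close> then \<open>b(y) \<ge> b(x,y)\<close> is at least a rational multiple of \<open>b(x)\<close>.  Hence on an
  irreducible class all ratios \<open>b(x)/b(a)\<close> are bounded and not infinitesimal, and
  \<open>\<beta>(x) = \<rho>(b(x)/b(a))\<close> is balanced because \<open>\<pi>(x,y)\<beta>(x) = \<rho>(b(x,y)/b(a))\<close> is symmetric.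

  Conversely, take for \<open>K\<close> the ultrapower of the reals.  The reachability preorder on the countable
  set \<open>V\<close> has a real height function \<open>h\<close>, and with the infinite number \<open>N = [n + 1]\<close> the weights
  \<open>b(x,y) = max {\<pi>(x,y)\<beta>(x)N\<^sup>h\<^sup>(\<^sup>x\<^sup>), \<pi>(y,x)\<beta>(y)N\<^sup>h\<^sup>(\<^sup>y\<^sup>)}\<close> make every edge into a
  class negligible compared with the edges out of it.  Additional edges of weight \<open>1/N\<close> along an
  enumeration of \<open>V\<close> connect the graph.  All real parts are then ordinary limits as \<open>n \<rightarrow> \<infinity>\<close>.
\<close>

section \<open>Real parts\<close>

context ordered_field
begin

section \<open>Order and division in an ordered field\<close>

lemma lt_asym: "\<lbrakk>a \<prec> b; a \<in> carrier K; b \<in> carrier K\<rbrakk> \<Longrightarrow> \<not> b \<prec> a"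
  using lt_trans[of a b a] lt_irrefl[of a] by auto

lemma pos_Units: "\<lbrakk>a \<in> carrier K; \<zero> \<prec> a\<rbrakk> \<Longrightarrow> a \<in> Units K"
  unfolding field_Units using lt_irrefl[of "\<zero>"] by auto

lemma pos_inv_closed: "\<lbrakk>a \<in> carrier K; \<zero> \<prec> a\<rbrakk> \<Longrightarrow> inv a \<in> carrier K"
  by (simp add: pos_Units)

lemma pos_inv_mult:
  assumes "a \<in> carrier K" "\<zero> \<prec> a"
  shows "a \<otimes> inv a = \<one>" and "inv a \<otimes> a = \<one>"
  using assms by (simp_all add: pos_Units)

lemma fdiv_closed: "\<lbrakk>a \<in> carrier K; b \<in> carrier K; \<zero> \<prec> b\<rbrakk> \<Longrightarrow> a \<oslash> b \<in> carrier K"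
  by (simp add: fdiv_def pos_inv_closed pos_inv_mult)

lemma fdiv_mult: "\<lbrakk>a \<in> carrier K; b \<in> carrier K; \<zero> \<prec> b\<rbrakk> \<Longrightarrow> (a \<oslash> b) \<otimes> b = a"
  by (simp add: fdiv_def pos_inv_closed pos_inv_mult m_assoc)

lemma lt_mult_right_iff:
  assumes "a \<in> carrier K" "b \<in> carrier K" "c \<in> carrier K" "\<zero> \<prec> c"
  shows "a \<otimes> c \<prec> b \<otimes> c \<longleftrightarrow> a \<prec> b"
  using assms lt_mult_right[of a b c] lt_mult_right[of b a c] lt_total[of a b]
    lt_asym[of "a \<otimes> c" "b \<otimes> c"] lt_irrefl[of "a \<otimes> c"] by auto

lemma fdiv_less_iff:
  assumes "a \<in> carrier K" "b \<in> carrier K" "c \<in> carrier K" "\<zero> \<prec> b"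
  shows "a \<oslash> b \<prec> c \<longleftrightarrow> a \<prec> c \<otimes> b" and "c \<prec> a \<oslash> b \<longleftrightarrow> c \<otimes> b \<prec> a"
  using lt_mult_right_iff[of "a \<oslash> b" c b] lt_mult_right_iff[of c "a \<oslash> b" b]
    fdiv_closed[of a b] fdiv_mult[of a b] assms by auto

lemma fdiv_self: "\<lbrakk>a \<in> carrier K; \<zero> \<prec> a\<rbrakk> \<Longrightarrow> a \<oslash> a = \<one>"
  by (simp add: fdiv_def pos_inv_closed pos_inv_mult)

lemma zero_fdiv: "\<lbrakk>a \<in> carrier K; \<zero> \<prec> a\<rbrakk> \<Longrightarrow> \<zero> \<oslash> a = \<zero>"
  by (simp add: fdiv_def pos_inv_closed pos_inv_mult)

lemma fdiv_nonneg:
  assumes "a \<in> carrier K" "nonneg K a" "c \<in> carrier K" "\<zero> \<prec> c"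
  shows "nonneg K (a \<oslash> c)"
  using assms fdiv_less_iff(2)[of a c \<zero>] zero_fdiv[of c] by (auto simp: nonneg_def)

text \<open>The factors are changed one at a time: the first change may be an equality, since
  \<open>c\<close> can be zero; the second is strict, since \<open>b\<close> is positive.\<close>

lemma lt_mult_mono:
  assumes "a \<in> carrier K" "b \<in> carrier K" "c \<in> carrier K" "d \<in> carrier K"
    and "a \<prec> b" "c \<prec> d" "\<zero> \<prec> b" "nonneg K c"
  shows "a \<otimes> c \<prec> b \<otimes> d"
proof -
  have "a \<otimes> c \<prec> b \<otimes> c \<or> a \<otimes> c = b \<otimes> c"
    using assms lt_mult_right[of a b c] by (auto simp: nonneg_def)
  moreover have "b \<otimes> c \<prec> b \<otimes> d"
    using assms lt_mult_right[of c d b] by (simp add: m_comm)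
  ultimately show ?thesis
    using lt_trans[of "a \<otimes> c" "b \<otimes> c" "b \<otimes> d"] assms by auto
qed

lemma finsum_nonneg:
  assumes "finite A" "\<And>y. y \<in> A \<Longrightarrow> f y \<in> carrier K \<and> nonneg K (f y)"
  shows "finsum K f A \<in> carrier K \<and> nonneg K (finsum K f A)"
  using assms
proof (induction A rule: finite_induct)
  case empty
  then show ?case by (simp add: nonneg_def)
next
  case (insert x A)
  let ?s = "finsum K f A"
  have *: "f x \<in> carrier K" "nonneg K (f x)" "?s \<in> carrier K" "nonneg K ?s"
    using insert by auto
  moreover have "\<zero> \<prec> f x \<oplus> ?s" if "\<zero> \<prec> f x" "\<zero> \<prec> ?s"
    using lt_add[of \<zero> "f x" ?s] lt_trans[of \<zero> ?s "f x \<oplus> ?s"] * that by auto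
  moreover have "finsum K f (insert x A) = f x \<oplus> ?s"
    using insert by (intro finsum_insert) auto
  ultimately show ?case
    by (auto simp: nonneg_def)
qed

text \<open>The remaining summands have a nonnegative sum. For vertex weights this is the bound
  \<open>b(x,y) <= b(x)\<close>, on which every comparison of weights rests.\<close>

lemma finsum_member_le:
  assumes "finite A" "\<And>y. y \<in> A \<Longrightarrow> f y \<in> carrier K \<and> nonneg K (f y)" and x: "x \<in> A"
  shows "f x \<prec> finsum K f A \<or> f x = finsum K f A"
proof -
  let ?s = "finsum K f (A - {x})"
  have s: "?s \<in> carrier K \<and> nonneg K ?s"
    using assms by (intro finsum_nonneg) auto
  have "finsum K f (insert x (A - {x})) = f x \<oplus> ?s"
    using assms by (intro finsum_insert) auto
  then have "finsum K f A = f x \<oplus> ?s"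
    using x by (simp add: insert_absorb)
  then show ?thesis
    using s assms lt_add[of \<zero> ?s "f x"] by (auto simp: nonneg_def a_comm)
qed

section \<open>Rational elements of the field\<close>

text \<open>\<open>rat_elem\<close> is defined through the reduced fraction. This rule recognises a
  rational element from any fraction, as is needed for products, where numerators and denominators
  multiply to an unreduced one.\<close>

lemma rat_elem_eqI:
  assumes "z \<in> carrier K" "d > 0" "z \<otimes> int_elem d = int_elem n"
  shows "z = rat_elem K (of_int n / of_int d)"
proof -
  define q :: rat where "q = of_int n / of_int d"
  define n' d' where "n' = fst (quotient_of q)" "d' = snd (quotient_of q)"
  have d': "d' > 0" using quotient_of_denom_pos' by (simp add: n'_d'_def)
  have "q = of_int n' / of_int d'" by (simp add: n'_d'_def quotient_of_div)
  then have "of_int (n * d') = (of_int (n' * d) :: rat)"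
    using d' assms(2) by (simp add: q_def field_simps)
  then have nd: "n * d' = n' * d" by linarith
  have r: "rat_elem K q \<in> carrier K" "rat_elem K q \<otimes> int_elem d' = int_elem n'"
    using rat_elem_mult_denom[of q] rat_elem_closed by (auto simp: n'_d'_def)
  have "z \<otimes> int_elem (d * d') = int_elem (n * d')"
    using assms by (simp add: int_elem_mult flip: m_assoc)
  also have "\<dots> = rat_elem K q \<otimes> int_elem (d' * d)"
    using r by (simp add: nd int_elem_mult flip: m_assoc)
  finally have "z \<otimes> int_elem (d * d') = rat_elem K q \<otimes> int_elem (d * d')"
    by (simp add: mult.commute)
  then show ?thesis
    using m_rcancel[of "int_elem (d * d')" z "rat_elem K q"] int_elem_nonzero[of "d * d'"] assms r d'
    by (auto simp: q_def)
qed

lemma rat_elem_one: "rat_elem K 1 = \<one>"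
  using rat_elem_eqI[of \<one> 1 1] by simp

lemma rat_elem_mult: "rat_elem K (p * q) = rat_elem K p \<otimes> rat_elem K q"
proof -
  define a b c d where abcd: "a = fst (quotient_of p)" "b = snd (quotient_of p)"
    "c = fst (quotient_of q)" "d = snd (quotient_of q)"
  let ?p = "rat_elem K p" and ?q = "rat_elem K q"
  have e: "?p \<otimes> int_elem b = int_elem a" "?q \<otimes> int_elem d = int_elem c"
    using rat_elem_mult_denom by (auto simp: abcd)
  have cl: "?p \<in> carrier K" "?q \<in> carrier K" by (rule rat_elem_closed)+
  have pos: "b > 0" "d > 0" using quotient_of_denom_pos' by (auto simp: abcd)
  have "(?p \<otimes> ?q) \<otimes> int_elem (b * d) = (?p \<otimes> int_elem b) \<otimes> (?q \<otimes> int_elem d)"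
    using cl by (simp add: int_elem_mult m_ac)
  also have "\<dots> = int_elem (a * c)"
    by (simp add: e int_elem_mult)
  finally have "?p \<otimes> ?q = rat_elem K (of_int (a * c) / of_int (b * d))"
    using cl pos by (intro rat_elem_eqI) auto
  moreover have "p = of_int a / of_int b" "q = of_int c / of_int d"
    by (auto simp: abcd quotient_of_div)
  ultimately show ?thesis by simp
qed

lemma rat_elem_pos: "q > 0 \<Longrightarrow> \<zero> \<prec> rat_elem K q"
  using rat_elem_mono[of 0 q] by (simp add: rat_elem_zero)

lemma rat_elem_less_iff: "rat_elem K p \<prec> rat_elem K q \<longleftrightarrow> p < q"
  using rat_elem_mono[of p q] rat_elem_mono[of q p] rat_elem_closed
    lt_asym[of "rat_elem K p" "rat_elem K q"] lt_irrefl[of "rat_elem K p"]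
  by (cases p q rule: linorder_cases) auto

section \<open>Uniqueness, sign and products of real parts\<close>

lemma is_real_part_unique:
  assumes k: "k \<in> carrier K" and "is_real_part K k r" "is_real_part K k s"
  shows "r = s"
proof -
  have "\<not> r < s" if "is_real_part K k r" "is_real_part K k s" for r s
  proof
    assume "r < s"
    then obtain q where "r < real_of_rat q" "real_of_rat q < s"
      using of_rat_dense by blast
    then have "k \<prec> rat_elem K q" "rat_elem K q \<prec> k"
      using that by (auto simp: is_real_part_def)
    then show False
      using lt_asym k rat_elem_closed by blast
  qed
  from this[of r s] this[of s r] assms show ?thesis by auto
qed

lemma real_part_eqI: "\<lbrakk>k \<in> carrier K; is_real_part K k r\<rbrakk> \<Longrightarrow> real_part K k = r"
  unfolding real_part_def by (intro the_equality) (auto dest: is_real_part_unique)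

lemma is_real_part_real_part:
  "\<lbrakk>k \<in> carrier K; bounded_elem K k\<rbrakk> \<Longrightarrow> is_real_part K k (real_part K k)"
  unfolding real_part_def using ex1_real_part by (rule theI')

lemma is_real_part_rat_elem: "is_real_part K (rat_elem K q) (of_rat q)"
  by (auto simp: is_real_part_def rat_elem_less_iff of_rat_less)

lemma bounded_elemI:
  assumes "k \<in> carrier K" "nonneg K k" "k \<prec> rat_elem K c"
  shows "bounded_elem K k"
proof -
  have "\<not> k \<prec> \<zero>"
    using assms lt_asym[of \<zero> k] lt_irrefl[of \<zero>] by (auto simp: nonneg_def)
  moreover have "\<zero> \<prec> rat_elem K c"
    using assms lt_trans[of \<zero> k "rat_elem K c"] rat_elem_closed by (auto simp: nonneg_def)
  then have "c > 0"
    using rat_elem_less_iff[of 0 c] by (simp add: rat_elem_zero)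
  ultimately show ?thesis
    using assms by (auto simp: bounded_elem_def fabs_def)
qed

lemma real_part_nonneg:
  assumes "k \<in> carrier K" "nonneg K k" "is_real_part K k r"
  shows "0 \<le> r"
proof (rule ccontr)
  assume "\<not> 0 \<le> r"
  then have "k \<prec> \<zero>"
    using assms(3) unfolding is_real_part_def by (metis linorder_not_le of_rat_0 rat_elem_zero)
  then show False
    using assms lt_asym[of \<zero> k] lt_irrefl[of \<zero>] by (auto simp: nonneg_def)
qed

text \<open>A positive \<open>k\<close> may be infinitesimal and then has real part 0; a positive
  rational lower bound rules this out.\<close>

lemma real_part_pos:
  assumes "k \<in> carrier K" "rat_elem K q \<prec> k" "0 < q" "is_real_part K k r"
  shows "0 < r"
proof (rule ccontr)
  assume "\<not> 0 < r"
  then have "r < of_rat q"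
    using \<open>0 < q\<close> zero_less_of_rat_iff[of q, where 'a = real] by linarith
  then have "k \<prec> rat_elem K q"
    using assms(4) by (auto simp: is_real_part_def)
  then show False
    using assms lt_asym rat_elem_closed by blast
qed

text \<open>A rational below (above) \<open>r * s\<close> is also below (above) a product of
  rationals \<open>u\<close>, \<open>v\<close> that lie below (above) \<open>r\<close> and
  \<open>s\<close>. Monotonicity of the product carries this over to \<open>k\<close> and
  \<open>l\<close>.\<close>

lemma is_real_part_mult:
  assumes k: "k \<in> carrier K" "nonneg K k" "is_real_part K k r"
    and l: "l \<in> carrier K" "nonneg K l" "is_real_part K l s"
  shows "is_real_part K (k \<otimes> l) (r * s)"
  unfolding is_real_part_def
proof (intro allI conjI impI)
  fix q :: rat
  note rc = rat_elem_closed
  have nn: "nonneg K (k \<otimes> l)"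
    using k l lt_mult[of k l] by (auto simp: nonneg_def)
  have rs: "0 \<le> r" "0 \<le> s"
    using k l real_part_nonneg by blast+
  show "rat_elem K q \<prec> k \<otimes> l" if q: "of_rat q < r * s"
  proof (cases "q < 0")
    case True
    then show ?thesis
      using nn rat_elem_mono[of q 0] lt_trans[of "rat_elem K q" \<zero> "k \<otimes> l"] k l rc
      by (auto simp: nonneg_def rat_elem_zero)
  next
    case False
    then have "0 \<le> real_of_rat q"
      by simp
    then have "0 < r * s"
      using q by linarith
    with rs have rs: "0 < r" "0 < s"
      by (auto simp: zero_less_mult_iff)
    \<comment> \<open>The maximum with 0 makes \<open>u\<close> positive besides
      \<open>q / s < u\<close>; then \<open>q / u < s\<close> leaves room for
      \<open>v\<close>.\<close>
    have "max 0 (of_rat q / s) < r"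
      using q rs by (simp add: pos_divide_less_eq)
    then obtain u where u: "max 0 (of_rat q / s) < real_of_rat u" "of_rat u < r"
      using of_rat_dense by blast
    then have "max 0 (of_rat q / of_rat u) < s"
      using rs by (auto simp: pos_divide_less_eq mult.commute)
    then obtain v where v: "max 0 (of_rat q / of_rat u) < real_of_rat v" "of_rat v < s"
      using of_rat_dense by blast
    have "real_of_rat q < of_rat (v * u)" "u > 0" "v > 0"
      using u v by (auto simp: pos_divide_less_eq of_rat_mult)
    then have "rat_elem K q \<prec> rat_elem K v \<otimes> rat_elem K u" "\<zero> \<prec> rat_elem K u" "\<zero> \<prec> rat_elem K v"
      by (auto simp: rat_elem_mono rat_elem_pos of_rat_less simp flip: rat_elem_mult)
    moreover have "rat_elem K u \<prec> k" "rat_elem K v \<prec> l"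
      using u v k l by (auto simp: is_real_part_def)
    ultimately show ?thesis
      using lt_mult_mono[of "rat_elem K v" l "rat_elem K u" k] k l rc
        lt_trans[of \<zero> "rat_elem K v" l] lt_trans[of "rat_elem K q" "rat_elem K v \<otimes> rat_elem K u" "k \<otimes> l"]
      by (auto simp: nonneg_def m_comm)
  qed
  show "k \<otimes> l \<prec> rat_elem K q" if q: "r * s < of_rat q"
  proof -
    have "0 < real_of_rat q"
      using q mult_nonneg_nonneg[OF rs] by linarith
    \<comment> \<open>\<open>t\<close> leaves room for a rational \<open>v\<close> above
      \<open>s\<close>. For \<open>r > 0\<close> it lies between \<open>s\<close> and
      \<open>q / r\<close>; for \<open>r = 0\<close> any number above \<open>s\<close> will do,
      because \<open>q\<close> is positive.\<close>
    obtain t where t: "s < t" "r * t < of_rat q"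
    proof (cases "r = 0")
      case True
      then show ?thesis using that[of "s + 1"] \<open>0 < real_of_rat q\<close> by simp
    next
      case False
      with rs have "0 < r" by simp
      with q have "s < of_rat q / r" by (simp add: pos_less_divide_eq mult.commute)
      with \<open>0 < r\<close> dense[of s "of_rat q / r"] that show ?thesis
        by (auto simp: pos_less_divide_eq mult.commute)
    qed
    then obtain v where v: "s < of_rat v" "real_of_rat v < t"
      using of_rat_dense by blast
    have "0 < real_of_rat v" using v rs by linarith
    have "r * of_rat v < of_rat q"
      using v t mult_left_mono[of "of_rat v" t r] rs by linarith
    with \<open>0 < real_of_rat v\<close> have "r < of_rat q / of_rat v"
      by (simp add: pos_less_divide_eq)
    then obtain u where u: "r < of_rat u" "real_of_rat u < of_rat q / of_rat v"
      using of_rat_dense by blast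
    have "0 < real_of_rat u"
      using u rs by linarith
    moreover have "of_rat (u * v) < real_of_rat q"
      using u \<open>0 < real_of_rat v\<close> by (simp add: pos_less_divide_eq of_rat_mult)
    ultimately have "rat_elem K u \<otimes> rat_elem K v \<prec> rat_elem K q" "\<zero> \<prec> rat_elem K u"
      by (auto simp: rat_elem_mono rat_elem_pos of_rat_less simp flip: rat_elem_mult)
    moreover have "k \<prec> rat_elem K u" "l \<prec> rat_elem K v"
      using u v k l by (auto simp: is_real_part_def)
    ultimately show ?thesis
      using lt_mult_mono[of k "rat_elem K u" l "rat_elem K v"] k l rc
        lt_trans[of "k \<otimes> l" "rat_elem K u \<otimes> rat_elem K v" "rat_elem K q"]
      by auto
  qed
qed

end

section \<open>Matrices represented by weighted graphs\<close>

lemma equiv_communicates: "equiv V (communicates V \<pi>)"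
  by (rule equivI) (auto simp: communicates_def reach_def refl_on_def sym_def trans_def
      intro: rtrancl_trans)

lemma irreducible_class_eq:
  assumes "C \<in> irreducible_classes V \<pi>" "x \<in> C"
  shows "communicates V \<pi> `` {x} = C" and "x \<in> V"
    and "y \<in> C \<Longrightarrow> (x, y) \<in> reach V \<pi>"
proof -
  obtain c where c: "C = communicates V \<pi> `` {c}" "c \<in> V"
    using assms by (auto simp: irreducible_classes_def elim: quotientE)
  then have "(c, x) \<in> communicates V \<pi>"
    using assms by auto
  then show eq: "communicates V \<pi> `` {x} = C"
    using c equiv_class_eq[OF equiv_communicates] by metis
  show "x \<in> V"
    using \<open>(c, x) \<in> communicates V \<pi>\<close> by (auto simp: communicates_def)
  show "(x, y) \<in> reach V \<pi>" if "y \<in> C"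
    using that by (auto simp: communicates_def simp flip: eq)
qed

lemma irreducible_class_nonempty: "C \<in> irreducible_classes V \<pi> \<Longrightarrow> C \<noteq> {}"
  unfolding irreducible_classes_def using in_quotient_imp_non_empty equiv_communicates by blast

text \<open>\<open>nontrivial\<close> excludes a one-point \<open>V\<close>, where the vertex weight
  is zero and the quotients \<open>p(x,y)\<close> make no sense; \<open>represents_imp\<close>
  treats that case apart.\<close>

locale represented_matrix = ordered_field K for K :: "('a, 'm) ordered_ring_scheme" (structure) +
  fixes V U :: "'v set" and b :: "'v \<Rightarrow> 'v \<Rightarrow> 'a" and \<pi> :: "'v \<Rightarrow> 'v \<Rightarrow> real"
  assumes weighted: "weighted_graph K V b"
    and connected: "connected_graph K V b"
    and locally_finite: "locally_finite_graph K V b"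
    and U: "U \<subseteq> V"
    and matrix: "\<lbrakk>x \<in> V; y \<in> V\<rbrakk> \<Longrightarrow> \<pi> x y = real_matrix K V U b x y"
    and transition: "transition_matrix V \<pi>"
    and nontrivial: "x \<in> V \<Longrightarrow> V \<noteq> {x}"
begin

section \<open>Vertex weights and transition probabilities\<close>

abbreviation w :: "'v \<Rightarrow> 'a" where "w x \<equiv> vweight K V b x"

lemma b_closed: "\<lbrakk>x \<in> V; y \<in> V\<rbrakk> \<Longrightarrow> b x y \<in> carrier K"
  and b_nonneg: "\<lbrakk>x \<in> V; y \<in> V\<rbrakk> \<Longrightarrow> nonneg K (b x y)"
  and b_sym: "\<lbrakk>x \<in> V; y \<in> V\<rbrakk> \<Longrightarrow> b x y = b y x"
  and b_diag: "x \<in> V \<Longrightarrow> b x x = \<zero>"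
  using weighted unfolding weighted_graph_def by blast+

lemma finite_neighbours:
  assumes "x \<in> V" shows "finite {y \<in> V. b x y \<noteq> \<zero>}"
proof (rule finite_subset)
  show "{y \<in> V. b x y \<noteq> \<zero>} \<subseteq> {y. (y, x) \<in> adjacency K V b}"
  proof
    fix y assume "y \<in> {y \<in> V. b x y \<noteq> \<zero>}"
    then show "y \<in> {y. (y, x) \<in> adjacency K V b}"
      using b_nonneg[of x y] b_sym[of x y] assms by (auto simp: adjacency_def nonneg_def)
  qed
  show "finite {y. (y, x) \<in> adjacency K V b}"
    using locally_finite assms by (auto simp: locally_finite_graph_def)
qed

lemma w_closed: "x \<in> V \<Longrightarrow> w x \<in> carrier K" and w_nonneg: "x \<in> V \<Longrightarrow> nonneg K (w x)"
  using finsum_nonneg[OF finite_neighbours, of x "b x"] b_closed b_nonneg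
  by (auto simp: vweight_def)

lemma b_le_w:
  assumes "x \<in> V" "y \<in> V" shows "b x y \<prec> w x \<or> b x y = w x"
\<comment> \<open>\<open>vweight\<close> sums over the support only, so a vanishing
  \<open>b x y\<close> is not one of the summands.\<close>
proof (cases "b x y = \<zero>")
  case True
  then show ?thesis
    using w_nonneg[OF assms(1)] by (auto simp: nonneg_def)
next
  case False
  then show ?thesis
    unfolding vweight_def using assms b_closed b_nonneg
    by (intro finsum_member_le finite_neighbours) auto
qed

text \<open>A path from \<open>x\<close> to another vertex exists by connectedness, and its first
  edge has positive weight.\<close>

lemma w_pos: assumes x: "x \<in> V" shows "\<zero> \<prec> w x"
proof -
  obtain z where z: "z \<in> V" "z \<noteq> x"
    using nontrivial[OF x] x by blast
  then have "(x, z) \<in> (adjacency K V b)\<^sup>*"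
    using connected x by (auto simp: connected_graph_def)
  with z obtain y where y: "y \<in> V" "\<zero> \<prec> b x y"
    by (auto simp: adjacency_def elim: converse_rtranclE)
  then show ?thesis
    using b_le_w[OF x, of y] lt_trans[of \<zero> "b x y" "w x"] b_closed[of x y] w_closed x by auto
qed

lemma trans_prob_closed: "\<lbrakk>x \<in> V; y \<in> V\<rbrakk> \<Longrightarrow> trans_prob K V b x y \<in> carrier K"
  unfolding trans_prob_def by (intro fdiv_closed b_closed w_closed w_pos)

lemma trans_prob_nonneg: "\<lbrakk>x \<in> V; y \<in> V\<rbrakk> \<Longrightarrow> nonneg K (trans_prob K V b x y)"
  unfolding trans_prob_def by (intro fdiv_nonneg b_closed w_closed w_pos b_nonneg)

lemma rat_elem_mult_w_mono:
  assumes "x \<in> V" "p < q" shows "rat_elem K p \<otimes> w x \<prec> rat_elem K q \<otimes> w x"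
  by (intro lt_mult_right rat_elem_mono rat_elem_closed w_closed w_pos assms)

lemma bounded_trans_prob:
  assumes "x \<in> V" "y \<in> V" shows "bounded_elem K (trans_prob K V b x y)"
proof (rule bounded_elemI)
  \<comment> \<open>The bound has to be strict, while \<open>b x y = w x\<close> may occur; hence
    the constant 2 in place of 1.\<close>
  have "w x \<prec> rat_elem K 2 \<otimes> w x"
    using rat_elem_mult_w_mono[of x 1 2] assms w_closed by (simp add: rat_elem_one)
  then have "b x y \<prec> rat_elem K 2 \<otimes> w x"
    using b_le_w[OF assms] lt_trans[of "b x y" "w x" "rat_elem K 2 \<otimes> w x"] assms
      b_closed w_closed rat_elem_closed by auto
  then show "trans_prob K V b x y \<prec> rat_elem K 2"
    using assms by (simp add: trans_prob_def fdiv_less_iff b_closed w_closed w_pos rat_elem_closed)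
qed (use assms trans_prob_closed trans_prob_nonneg in auto)

lemma is_real_part_trans_prob:
  assumes "x \<in> U" "y \<in> V" shows "is_real_part K (trans_prob K V b x y) (\<pi> x y)"
  using assms U matrix[of x y] is_real_part_real_part[OF trans_prob_closed bounded_trans_prob]
  by (auto simp: real_matrix_def)

section \<open>Comparison of vertex weights along reachability\<close>

text \<open>A division-free way to say that \<open>w x / w y\<close> is bounded by a rational.
  Domination in both directions makes the ratio finite and not infinitesimal.\<close>

definition dominated :: "'v \<Rightarrow> 'v \<Rightarrow> bool"
  where "dominated x y \<longleftrightarrow> (\<exists>q>0. rat_elem K q \<otimes> w x \<prec> w y)"

lemma dominated_refl: "x \<in> V \<Longrightarrow> dominated x x"
  using rat_elem_mult_w_mono[of x "1/2" 1] w_closed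
  by (auto simp: dominated_def rat_elem_one intro!: exI[of _ "1/2"])

lemma dominated_trans:
  assumes V: "x \<in> V" "y \<in> V" "z \<in> V" and "dominated x y" "dominated y z"
  shows "dominated x z"
proof -
  obtain p q where pq: "p > 0" "q > 0" "rat_elem K p \<otimes> w x \<prec> w y" "rat_elem K q \<otimes> w y \<prec> w z"
    using assms by (auto simp: dominated_def)
  note cl = rat_elem_closed w_closed[OF V(1)] w_closed[OF V(2)] w_closed[OF V(3)]
  have "(rat_elem K p \<otimes> w x) \<otimes> rat_elem K q \<prec> w y \<otimes> rat_elem K q"
    using pq cl by (intro lt_mult_right rat_elem_pos) auto
  then have "rat_elem K (q * p) \<otimes> w x \<prec> rat_elem K q \<otimes> w y"
    using cl by (simp add: rat_elem_mult m_ac)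
  then have "rat_elem K (q * p) \<otimes> w x \<prec> w z"
    using pq(4) cl lt_trans[of "rat_elem K (q * p) \<otimes> w x" "rat_elem K q \<otimes> w y" "w z"] by auto
  then show ?thesis
    using pq by (auto simp: dominated_def intro!: exI[of _ "q * p"])
qed

text \<open>Symmetry of \<open>b\<close> is what turns a positive outgoing probability at
  \<open>x\<close> into a lower bound for the weight at \<open>y\<close>. Outside \<open>U\<close>
  the matrix is the identity, so there the step is a loop.\<close>

lemma dominated_step:
  assumes "x \<in> V" "y \<in> V" "\<pi> x y \<noteq> 0"
  shows "dominated x y"
proof (cases "x \<in> U")
  case True
  have "0 < \<pi> x y"
    using assms transition unfolding transition_matrix_def by force
  then obtain q where q: "0 < real_of_rat q" "real_of_rat q < \<pi> x y"
    using of_rat_dense by blast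
  then have "rat_elem K q \<prec> trans_prob K V b x y"
    using is_real_part_trans_prob[OF True assms(2)] by (auto simp: is_real_part_def)
  then have "rat_elem K q \<otimes> w x \<prec> b y x"
    using assms b_sym[of x y]
    by (simp add: trans_prob_def fdiv_less_iff b_closed w_closed w_pos rat_elem_closed)
  then have "rat_elem K q \<otimes> w x \<prec> w y"
    using b_le_w[of y x] assms lt_trans[of "rat_elem K q \<otimes> w x" "b y x" "w y"]
      b_closed w_closed rat_elem_closed by auto
  then show ?thesis
    using q by (auto simp: dominated_def)
next
  case False
  then have "x = y"
    using assms matrix[of x y] by (auto simp: real_matrix_def split: if_splits)
  then show ?thesis
    using dominated_refl assms by auto
qed

lemma reach_dominated:
  assumes "(x, y) \<in> reach V \<pi>" "x \<in> V"
  shows "y \<in> V \<and> dominated x y"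
  using assms(1) unfolding reach_def
proof (induction rule: rtrancl_induct)
  case base
  then show ?case using dominated_refl assms(2) by auto
next
  case (step y z)
  then show ?case using dominated_step[of y z] dominated_trans[of x y z] assms(2) by auto
qed

text \<open>Rows outside \<open>U\<close> are identity rows. Consequently non-absorbing states, and
  members of classes with several elements, lie in \<open>U\<close>.\<close>

lemma reach_outside:
  assumes "(x, y) \<in> reach V \<pi>" "x \<notin> U"
  shows "y = x"
  using assms(1) unfolding reach_def
proof (induction rule: rtrancl_induct)
  case (step y z)
  then show ?case using matrix[of y z] assms(2) by (auto simp: real_matrix_def split: if_splits)
qed simp

text \<open>A non-absorbing state lies in \<open>U\<close>, where the diagonal entry is the real
  part of \<open>b x x / w x\<close>, and the graph has no loops.\<close>

lemma diag_zero:
  assumes "x \<in> V" "\<not> absorbing V \<pi> x" shows "\<pi> x x = 0"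
proof -
  have "x \<in> U"
    using assms reach_outside by (auto simp: absorbing_def)
  then have "is_real_part K (rat_elem K 0) (\<pi> x x)"
    using is_real_part_trans_prob[of x x] assms b_diag zero_fdiv[OF w_closed w_pos]
    by (simp add: trans_prob_def rat_elem_zero)
  then show ?thesis
    using is_real_part_unique[OF rat_elem_closed _ is_real_part_rat_elem, of 0 "\<pi> x x"] by simp
qed

text \<open>The two dominations put the ratio between the positive rationals \<open>p\<close> and
  \<open>1/q\<close>; the lower bound keeps its real part away from 0.\<close>

lemma weight_ratio:
  assumes V: "x \<in> V" "a \<in> V" and "dominated x a" "dominated a x"
  shows "bounded_elem K (w x \<oslash> w a)" and "0 < real_part K (w x \<oslash> w a)"
proof -
  have cl: "w x \<oslash> w a \<in> carrier K" "nonneg K (w x \<oslash> w a)"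
    using V w_closed w_pos w_nonneg by (auto intro!: fdiv_closed fdiv_nonneg)
  obtain q where q: "q > 0" "rat_elem K q \<otimes> w x \<prec> w a"
    using assms by (auto simp: dominated_def)
  have "(rat_elem K q \<otimes> w x) \<otimes> rat_elem K (1/q) \<prec> w a \<otimes> rat_elem K (1/q)"
    using q V w_closed rat_elem_closed by (intro lt_mult_right rat_elem_pos) auto
  moreover have "(rat_elem K q \<otimes> w x) \<otimes> rat_elem K (1/q) = rat_elem K (q * (1/q)) \<otimes> w x"
    unfolding rat_elem_mult using V w_closed rat_elem_closed by (simp add: m_ac)
  ultimately have "w x \<prec> rat_elem K (1/q) \<otimes> w a"
    using q V w_closed rat_elem_closed by (simp add: rat_elem_one m_comm)
  then have "w x \<oslash> w a \<prec> rat_elem K (1/q)"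
    using V by (simp add: fdiv_less_iff w_closed w_pos rat_elem_closed)
  then show bd: "bounded_elem K (w x \<oslash> w a)"
    using bounded_elemI cl by blast
  obtain p where p: "p > 0" "rat_elem K p \<otimes> w a \<prec> w x"
    using assms by (auto simp: dominated_def)
  then have "rat_elem K p \<prec> w x \<oslash> w a"
    using V by (simp add: fdiv_less_iff w_closed w_pos rat_elem_closed)
  then show "0 < real_part K (w x \<oslash> w a)"
    using real_part_pos is_real_part_real_part cl bd p by blast
qed

lemma balanced_normalised:
  "\<exists>\<beta>. balanced_on_classes V \<pi> \<beta> \<and> normalised_by_weights K V b \<pi> \<beta>"
proof -
  \<comment> \<open>The choice depends on the class as a set only, so all its members share one
    reference vertex \<open>a\<close>.\<close>
  define rep where "rep x = (SOME y. y \<in> communicates V \<pi> `` {x})" for x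
  define \<beta> where "\<beta> x = real_part K (w x \<oslash> w (rep x))" for x
  have base: "\<exists>a\<in>C. \<forall>x\<in>C. x \<in> V \<and> dominated x a \<and> dominated a x \<and>
      \<beta> x = real_part K (w x \<oslash> w a)" if C: "C \<in> irreducible_classes V \<pi>" for C
  proof -
    define a where "a = (SOME y. y \<in> C)"
    have a: "a \<in> C"
      unfolding a_def using irreducible_class_nonempty[OF C] some_in_eq by blast
    have "\<forall>x\<in>C. rep x = a"
      using irreducible_class_eq(1)[OF C] by (simp add: rep_def a_def)
    then have "\<forall>x\<in>C. x \<in> V \<and> dominated x a \<and> dominated a x \<and> \<beta> x = real_part K (w x \<oslash> w a)"
      using irreducible_class_eq(2,3)[OF C] a reach_dominated by (simp add: \<beta>_def)
    with a show ?thesis by blast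
  qed
  have pos: "0 < \<beta> x" if x: "x \<in> V" for x
  proof -
    have "communicates V \<pi> `` {x} \<in> irreducible_classes V \<pi>" "x \<in> communicates V \<pi> `` {x}"
      using x equiv_class_self[OF equiv_communicates] by (auto simp: irreducible_classes_def intro: quotientI)
    with base obtain a where "a \<in> communicates V \<pi> `` {x}" "dominated x a" "dominated a x"
        "\<beta> x = real_part K (w x \<oslash> w a)"
      by metis
    then show ?thesis
      using weight_ratio(2)[of x a] x by (auto simp: communicates_def)
  qed
  have bal: "\<pi> x y * \<beta> x = \<pi> y x * \<beta> y"
    if C: "C \<in> irreducible_classes V \<pi>" and xy: "x \<in> C" "y \<in> C" for C x y
  proof (cases "x = y")
    case False
    then have "x \<in> U" "y \<in> U"
      using irreducible_class_eq(3)[OF C] xy reach_outside by metis+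
    obtain a where a: "a \<in> C" and aC: "\<forall>x\<in>C. x \<in> V \<and> dominated x a \<and> dominated a x \<and>
        \<beta> x = real_part K (w x \<oslash> w a)"
      using base[OF C] by blast
    \<comment> \<open>The weight \<open>w x\<close> cancels in the product of \<open>p(x,y)\<close>
      and \<open>w x / w a\<close>. Used for \<open>(x,y)\<close> and \<open>(y,x)\<close>, this
      gives one element two real parts, which must agree.\<close>
    have "is_real_part K (b x y \<oslash> w a) (\<pi> x y * \<beta> x)" if "x \<in> C" "y \<in> C" "x \<in> U" for x y
    proof -
      have V: "x \<in> V" "y \<in> V" "a \<in> V" using that aC a by auto
      have d: "dominated x a" "dominated a x" "\<beta> x = real_part K (w x \<oslash> w a)"
        using that aC by auto
      have cl: "w x \<oslash> w a \<in> carrier K" "nonneg K (w x \<oslash> w a)"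
        using V w_closed w_pos w_nonneg by (auto intro!: fdiv_closed fdiv_nonneg)
      have "is_real_part K (w x \<oslash> w a) (\<beta> x)"
        using is_real_part_real_part[OF cl(1) weight_ratio(1)] V d by simp
      then have "is_real_part K (trans_prob K V b x y \<otimes> (w x \<oslash> w a)) (\<pi> x y * \<beta> x)"
        using V that cl by (intro is_real_part_mult trans_prob_closed trans_prob_nonneg is_real_part_trans_prob)
      moreover have "trans_prob K V b x y \<otimes> (w x \<oslash> w a) = b x y \<oslash> w a"
        using V fdiv_mult[of "b x y" "w x"] b_closed[of x y] w_closed w_pos
          trans_prob_closed[of x y] pos_inv_closed[of "w a"]
        by (simp add: fdiv_def[of _ _ "w a"] trans_prob_def flip: m_assoc)
      ultimately show ?thesis by simp
    qed
    from this[of x y] this[of y x] have "is_real_part K (b x y \<oslash> w a) (\<pi> x y * \<beta> x)"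
      "is_real_part K (b x y \<oslash> w a) (\<pi> y x * \<beta> y)"
      using xy \<open>x \<in> U\<close> \<open>y \<in> U\<close> aC b_sym[of x y] by auto
    then show ?thesis
      using is_real_part_unique fdiv_closed[OF b_closed w_closed w_pos] xy a aC by blast
  qed simp
  have "normalised_by_weights K V b \<pi> \<beta>"
    unfolding normalised_by_weights_def
  proof
    fix C assume C: "C \<in> irreducible_classes V \<pi>"
    obtain a where a: "a \<in> C" and aC: "\<forall>x\<in>C. x \<in> V \<and> dominated x a \<and> dominated a x \<and>
        \<beta> x = real_part K (w x \<oslash> w a)"
      using base[OF C] by blast
    have "\<beta> a = real_part K (rat_elem K 1)"
      using a aC fdiv_self[OF w_closed w_pos] by (simp add: rat_elem_one)
    also have "\<dots> = 1"
      using real_part_eqI[OF rat_elem_closed is_real_part_rat_elem, of 1] by simp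
    finally show "\<exists>a\<in>C. \<beta> a = 1 \<and> (V \<noteq> {a} \<longrightarrow> (\<forall>x\<in>C. bounded_elem K (w x \<oslash> w a) \<and>
        \<beta> x = real_part K (w x \<oslash> w a)))"
      using a aC weight_ratio(1) by blast
  qed
  with pos bal show ?thesis
    unfolding balanced_on_classes_def by blast
qed

end

lemma represents_imp:
  assumes "transition_matrix V \<pi>" and rep: "represents K V U b \<pi>"
  shows "(\<exists>\<beta>. balanced_on_classes V \<pi> \<beta> \<and> normalised_by_weights K V b \<pi> \<beta>) \<and>
    (\<forall>x\<in>V. \<not> absorbing V \<pi> x \<longrightarrow> \<pi> x x = 0)"
proof (cases "\<exists>a. V = {a}")
  case True
  then obtain a where a: "V = {a}" ..
  \<comment> \<open>The only class is \<open>{a}\<close>. The constant 1 is balanced on it, and the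
    guard \<open>V \<noteq> {a}\<close> leaves only \<open>\<beta> a = 1\<close> to be
    shown.\<close>
  then have "C = {a}" if "C \<in> irreducible_classes V \<pi>" for C
    using irreducible_class_nonempty[OF that] irreducible_class_eq(2)[OF that] by blast
  then have "balanced_on_classes V \<pi> (\<lambda>_. 1)" "normalised_by_weights K V b \<pi> (\<lambda>_. 1)"
    using a by (auto simp: balanced_on_classes_def normalised_by_weights_def)
  moreover have "absorbing V \<pi> a"
    using a by (auto simp: absorbing_def)
  ultimately show ?thesis
    using a by blast
next
  case False
  interpret ordered_field K
    using rep by (simp add: represents_def real_closed_field_def)
  interpret represented_matrix K V U b \<pi>
    using rep assms(1) False by unfold_locales (auto simp: represents_def)
  show ?thesis
    using balanced_normalised diag_zero by blast
qed

section \<open>A field of hyperreals\<close>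

text \<open>Zorn's lemma yields a minimal proper filter \<open>M\<close> below \<open>F0\<close>. It
  decides every \<open>P\<close>: unless \<open>\<not> P\<close> is eventual, restricting
  \<open>M\<close> to \<open>P\<close> leaves a proper filter, which equals \<open>M\<close> by
  minimality.\<close>

lemma ex_ultrafilter:
  fixes F0 :: "'a filter"
  assumes "F0 \<noteq> bot"
  shows "\<exists>F \<le> F0. F \<noteq> bot \<and> (\<forall>P. eventually P F \<or> eventually (\<lambda>x. \<not> P x) F)"
proof -
  let ?A = "{F. F \<noteq> bot \<and> F \<le> F0}" and ?P = "\<lambda>F G :: 'a filter. G \<le> F"
  have "\<exists>M\<in>?A. \<forall>G\<in>?A. G \<le> M \<longrightarrow> G = M"
  proof (rule predicate_Zorn)
    show "partial_order_on ?A (relation_of ?P ?A)"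
      by (intro partial_order_on_relation_ofI) auto
    show "\<exists>u\<in>?A. \<forall>F\<in>C. u \<le> F" if C: "C \<in> Chains (relation_of ?P ?A)" for C
    proof (cases "C = {}")
      case True
      then show ?thesis using assms by auto
    next
      case False
      have sub: "F \<noteq> bot" "F \<le> F0" if "F \<in> C" for F
        using C that by (auto simp: Chains_def relation_of_def)
      \<comment> \<open>A chain is directed, so whatever holds eventually in \<open>Inf C\<close>
        does so in some member already; hence the infimum stays proper.\<close>
      have "\<exists>x\<in>C. x \<le> inf F G" if "F \<in> C" "G \<in> C" for F G
        using C that by (fastforce simp: Chains_def relation_of_def)
      then have "eventually (\<lambda>_. False) (Inf C) \<longleftrightarrow> (\<exists>F\<in>C. eventually (\<lambda>_. False) F)"
        by (intro eventually_Inf_base False)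
      then have "Inf C \<noteq> bot"
        using sub by (simp add: trivial_limit_def)
      moreover have "Inf C \<le> F0"
        using False sub by (meson Inf_lower ex_in_conv order_trans)
      ultimately show ?thesis
        by (auto intro: Inf_lower)
    qed
  qed
  then obtain M where M: "M \<noteq> bot" "M \<le> F0"
    and max: "\<And>G. \<lbrakk>G \<noteq> bot; G \<le> F0; G \<le> M\<rbrakk> \<Longrightarrow> G = M"
    by auto
  have "eventually P M \<or> eventually (\<lambda>x. \<not> P x) M" for P
  proof (rule disjCI)
    assume "\<not> eventually (\<lambda>x. \<not> P x) M"
    then have "inf M (principal {x. P x}) \<noteq> bot"
      by (simp add: trivial_limit_def eventually_inf_principal)
    then have "inf M (principal {x. P x}) = M"
      using M(2) by (intro max) (auto intro: le_infI1)
    then show "eventually P M"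
      using eventually_inf_principal[of P M "{x. P x}"] by simp
  qed
  with M show ?thesis by blast
qed

text \<open>\<open>le_sequentially\<close> puts all cofinite sets into the ultrafilter. This makes
  it nonprincipal and turns ordinary limits into statements about the ultrapower.\<close>

locale nonprincipal_ultrafilter =
  fixes F :: "nat filter"
  assumes nontrivial: "F \<noteq> bot"
    and ultra: "eventually P F \<or> eventually (\<lambda>n. \<not> P n) F"
    and le_sequentially: "F \<le> sequentially"
begin

lemma eventually_not: "eventually (\<lambda>n. \<not> P n) F \<longleftrightarrow> \<not> eventually P F"
proof
  assume "eventually (\<lambda>n. \<not> P n) F"
  then show "\<not> eventually P F"
    using nontrivial eventually_conj[of P F "\<lambda>n. \<not> P n"] by (auto simp: trivial_limit_def)
qed (use ultra in blast)

lemma eventually_sequentially_imp: "eventually P sequentially \<Longrightarrow> eventually P F"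
  by (rule filter_leD[OF le_sequentially])

section \<open>The ultrapower of the reals\<close>

definition hyp :: "(nat \<Rightarrow> real) \<Rightarrow> (nat \<Rightarrow> real) set"
  where "hyp f = {g. eventually (\<lambda>n. f n = g n) F}"

definition rep :: "(nat \<Rightarrow> real) set \<Rightarrow> nat \<Rightarrow> real"
  where "rep u = (SOME f. hyp f = u)"

text \<open>The operations act on chosen representatives; \<open>add_hyp\<close>,
  \<open>mult_hyp\<close> and \<open>lt_hyp\<close> show that the choice does not matter.\<close>

definition hyperreals :: "(nat \<Rightarrow> real) set ordered_ring"
  where "hyperreals =
    \<lparr> carrier = range hyp,
      mult = \<lambda>u v. hyp (\<lambda>n. rep u n * rep v n),
      one = hyp (\<lambda>_. 1),
      zero = hyp (\<lambda>_. 0),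
      add = \<lambda>u v. hyp (\<lambda>n. rep u n + rep v n),
      lt = \<lambda>u v. eventually (\<lambda>n. rep u n < rep v n) F \<rparr>"

lemma hyp_eq_iff: "hyp f = hyp g \<longleftrightarrow> eventually (\<lambda>n. f n = g n) F"
proof
  assume "hyp f = hyp g"
  moreover have "g \<in> hyp g" by (simp add: hyp_def)
  ultimately have "g \<in> hyp f" by simp
  then show "eventually (\<lambda>n. f n = g n) F" by (simp add: hyp_def)
next
  assume *: "eventually (\<lambda>n. f n = g n) F"
  have "eventually (\<lambda>n. f n = h n) F \<longleftrightarrow> eventually (\<lambda>n. g n = h n) F" for h
    by (rule eventually_subst) (rule eventually_mono[OF *], simp)
  then show "hyp f = hyp g" by (simp add: hyp_def)
qed

lemma hyp_rep: "eventually (\<lambda>n. rep (hyp f) n = f n) F"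
proof -
  have "hyp (rep (hyp f)) = hyp f"
    unfolding rep_def by (rule someI[of "\<lambda>g. hyp g = hyp f"]) simp
  then show ?thesis by (simp add: hyp_eq_iff)
qed

abbreviation "HR \<equiv> hyperreals"

lemma hyp_closed: "hyp f \<in> carrier HR"
  by (simp add: hyperreals_def)

lemma carrierE: assumes "u \<in> carrier HR" obtains f where "u = hyp f"
  using assms by (auto simp: hyperreals_def)

lemma zero_hyp: "\<zero>\<^bsub>HR\<^esub> = hyp (\<lambda>_. 0)" and one_hyp: "\<one>\<^bsub>HR\<^esub> = hyp (\<lambda>_. 1)"
  by (simp_all add: hyperreals_def)

lemma add_hyp: "hyp f \<oplus>\<^bsub>HR\<^esub> hyp g = hyp (\<lambda>n. f n + g n)"
  unfolding hyperreals_def using hyp_rep[of f] hyp_rep[of g]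
  by (auto simp: hyp_eq_iff elim: eventually_elim2)

lemma mult_hyp: "hyp f \<otimes>\<^bsub>HR\<^esub> hyp g = hyp (\<lambda>n. f n * g n)"
  unfolding hyperreals_def using hyp_rep[of f] hyp_rep[of g]
  by (auto simp: hyp_eq_iff elim: eventually_elim2)

lemma lt_hyp: "hyp f \<prec>\<^bsub>HR\<^esub> hyp g \<longleftrightarrow> eventually (\<lambda>n. f n < g n) F"
  unfolding hyperreals_def ordered_ring.simps using hyp_rep[of f] hyp_rep[of g]
  by (intro eventually_cong) (auto elim: eventually_elim2)

lemmas hyp_simps = zero_hyp one_hyp add_hyp mult_hyp lt_hyp hyp_closed

lemma hyp_nonzero: "hyp f \<noteq> \<zero>\<^bsub>HR\<^esub> \<longleftrightarrow> eventually (\<lambda>n. f n \<noteq> 0) F"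
  by (simp add: zero_hyp hyp_eq_iff eventually_not)

text \<open>By the ultrafilter property a nonzero class has nonzero entries eventually, so the
  pointwise inverse serves; at the other indices \<open>inverse 0 = 0\<close> does no harm.\<close>

lemma hyp_inverse:
  assumes "hyp f \<noteq> \<zero>\<^bsub>HR\<^esub>"
  shows "hyp f \<otimes>\<^bsub>HR\<^esub> hyp (\<lambda>n. inverse (f n)) = \<one>\<^bsub>HR\<^esub>"
  unfolding mult_hyp one_hyp hyp_eq_iff
  using assms[unfolded hyp_nonzero] by (rule eventually_mono) simp

lemma cring_hyperreals: "cring HR"
proof (rule cringI)
  show "abelian_group HR"
  proof (rule abelian_groupI)
    fix u assume "u \<in> carrier HR"
    then obtain f where "u = hyp f" by (rule carrierE)
    then show "\<exists>v\<in>carrier HR. v \<oplus>\<^bsub>HR\<^esub> u = \<zero>\<^bsub>HR\<^esub>"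
      by (intro bexI[of _ "hyp (\<lambda>n. - f n)"]) (simp_all add: hyp_simps)
  qed (auto elim!: carrierE simp: hyp_simps add_ac)
  show "Group.comm_monoid HR"
    by (rule comm_monoidI) (auto elim!: carrierE simp: hyp_simps mult_ac)
qed (auto elim!: carrierE simp: hyp_simps distrib_right)

lemma field_hyperreals: "field HR"
proof (rule cring.cring_fieldI2[OF cring_hyperreals])
  show "\<zero>\<^bsub>HR\<^esub> \<noteq> \<one>\<^bsub>HR\<^esub>"
    using nontrivial by (simp add: zero_hyp one_hyp hyp_eq_iff trivial_limit_def)
next
  fix u assume "u \<in> carrier HR" "u \<noteq> \<zero>\<^bsub>HR\<^esub>"
  then show "\<exists>v\<in>carrier HR. u \<otimes>\<^bsub>HR\<^esub> v = \<one>\<^bsub>HR\<^esub>"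
    using hyp_inverse hyp_closed by (metis carrierE)
qed

lemma ordered_field_hyperreals: "ordered_field HR"
proof -
  interpret field HR by (rule field_hyperreals)
  show ?thesis
  proof
    fix u v assume "u \<in> carrier HR" "v \<in> carrier HR" "u \<noteq> v"
    then obtain f g where fg: "u = hyp f" "v = hyp g" "\<not> eventually (\<lambda>n. f n = g n) F"
      by (metis carrierE hyp_eq_iff)
    then have ne: "eventually (\<lambda>n. f n \<noteq> g n) F"
      by (simp add: eventually_not)
    \<comment> \<open>The order is total because the ultrafilter decides each comparison.\<close>
    have "eventually (\<lambda>n. f n < g n) F \<or> eventually (\<lambda>n. g n < f n) F"
    proof (rule disjCI)
      assume "\<not> eventually (\<lambda>n. g n < f n) F"
      then have "eventually (\<lambda>n. \<not> g n < f n) F"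
        by (simp add: eventually_not)
      with ne show "eventually (\<lambda>n. f n < g n) F"
        by eventually_elim simp
    qed
    then show "u \<prec>\<^bsub>HR\<^esub> v \<or> v \<prec>\<^bsub>HR\<^esub> u"
      by (simp add: fg lt_hyp)
  next
    fix u assume "u \<in> carrier HR"
    then show "\<not> u \<prec>\<^bsub>HR\<^esub> u"
      using nontrivial by (auto elim!: carrierE simp: lt_hyp trivial_limit_def)
  next
    fix u v w assume "u \<in> carrier HR" "v \<in> carrier HR" "w \<in> carrier HR" "u \<prec>\<^bsub>HR\<^esub> v" "v \<prec>\<^bsub>HR\<^esub> w"
    moreover from this obtain f g h where eq: "u = hyp f" "v = hyp g" "w = hyp h"
      by (elim carrierE)
    ultimately have "eventually (\<lambda>n. f n < g n) F" "eventually (\<lambda>n. g n < h n) F"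
      by (simp_all add: lt_hyp)
    then have "eventually (\<lambda>n. f n < h n) F"
      by eventually_elim simp
    then show "u \<prec>\<^bsub>HR\<^esub> w"
      by (simp add: eq lt_hyp)
  next
    fix u v w assume "u \<in> carrier HR" "v \<in> carrier HR" "w \<in> carrier HR" "u \<prec>\<^bsub>HR\<^esub> v"
    then show "u \<oplus>\<^bsub>HR\<^esub> w \<prec>\<^bsub>HR\<^esub> v \<oplus>\<^bsub>HR\<^esub> w"
      by (auto elim!: carrierE simp: lt_hyp add_hyp elim: eventually_mono)
  next
    fix u v assume "u \<in> carrier HR" "v \<in> carrier HR" "\<zero>\<^bsub>HR\<^esub> \<prec>\<^bsub>HR\<^esub> u" "\<zero>\<^bsub>HR\<^esub> \<prec>\<^bsub>HR\<^esub> v"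
    moreover from this obtain f g where eq: "u = hyp f" "v = hyp g"
      by (elim carrierE)
    ultimately have "eventually (\<lambda>n. 0 < f n) F" "eventually (\<lambda>n. 0 < g n) F"
      by (simp_all add: zero_hyp lt_hyp)
    then have "eventually (\<lambda>n. 0 < f n * g n) F"
      by eventually_elim simp
    then show "\<zero>\<^bsub>HR\<^esub> \<prec>\<^bsub>HR\<^esub> u \<otimes>\<^bsub>HR\<^esub> v"
      by (simp add: eq hyp_simps)
  qed
qed

sublocale HR: ordered_field HR
  by (rule ordered_field_hyperreals)

lemma fdiv_hyp:
  assumes "eventually (\<lambda>n. g n \<noteq> 0) F"
  shows "hyp f \<oslash>\<^bsub>HR\<^esub> hyp g = hyp (\<lambda>n. f n / g n)"
proof -
  have "hyp g \<otimes>\<^bsub>HR\<^esub> hyp (\<lambda>n. inverse (g n)) = \<one>\<^bsub>HR\<^esub>"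
    using assms by (intro hyp_inverse) (simp add: hyp_nonzero)
  then have "inv\<^bsub>HR\<^esub> hyp g = hyp (\<lambda>n. inverse (g n))"
    using HR.comm_inv_char hyp_closed by metis
  then show ?thesis
    by (simp add: fdiv_def mult_hyp divide_inverse)
qed

lemma nat_elem_hyp: "[n] \<cdot>\<^bsub>HR\<^esub> \<one>\<^bsub>HR\<^esub> = hyp (\<lambda>_. real n)"
  by (induction n) (simp_all add: hyp_simps add.commute)

lemma int_elem_hyp: "HR.int_elem k = hyp (\<lambda>_. of_int k)"
proof (cases "k \<ge> 0")
  case True
  then show ?thesis by (simp add: add_pow_int_ge nat_elem_hyp)
next
  case False
  have "hyp (\<lambda>_. of_int k) \<oplus>\<^bsub>HR\<^esub> hyp (\<lambda>_. real (nat (- k))) = \<zero>\<^bsub>HR\<^esub>"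
    using False by (simp add: hyp_simps)
  then have "\<ominus>\<^bsub>HR\<^esub> hyp (\<lambda>_. real (nat (- k))) = hyp (\<lambda>_. of_int k)"
    using HR.minus_equality hyp_closed by blast
  then show ?thesis
    using False by (simp add: add_pow_int_lt nat_elem_hyp)
qed

lemma rat_elem_hyp: "rat_elem HR q = hyp (\<lambda>_. of_rat q)"
proof -
  have "rat_elem HR q = hyp (\<lambda>_. of_int (fst (quotient_of q)) / of_int (snd (quotient_of q)))"
    unfolding rat_elem_def int_elem_hyp
    using quotient_of_denom_pos'[of q] by (intro fdiv_hyp) simp
  moreover have "q = of_int (fst (quotient_of q)) / of_int (snd (quotient_of q))"
    by (simp add: quotient_of_div)
  then have "real_of_rat q = of_int (fst (quotient_of q)) / of_int (snd (quotient_of q))"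
    by (metis of_rat_divide of_rat_of_int_eq)
  ultimately show ?thesis by simp
qed

text \<open>A convergent sequence eventually passes every rational on either side of its limit, and
  what holds for almost all indices holds along \<open>F\<close>.\<close>

lemma real_part_hyp:
  assumes "f \<longlonglongrightarrow> l" shows "real_part HR (hyp f) = l"
proof (rule HR.real_part_eqI[OF hyp_closed])
  show "is_real_part HR (hyp f) l"
    unfolding is_real_part_def rat_elem_hyp lt_hyp
    using order_tendstoD[OF assms] by (auto intro: eventually_sequentially_imp)
qed

lemma finsum_hyp:
  "finite A \<Longrightarrow> finsum HR (\<lambda>y. hyp (f y)) A = hyp (\<lambda>n. \<Sum>y\<in>A. f y n)"
  by (induction A rule: finite_induct) (simp_all add: hyp_simps Pi_def)

lemma pow_hyp: "hyp f [^]\<^bsub>HR\<^esub> (k::nat) = hyp (\<lambda>n. f n ^ k)"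
  by (induction k) (simp_all add: hyp_simps mult.commute)

lemma non_archimedean_hyperreals: "non_archimedean HR"
  unfolding non_archimedean_def
proof (intro bexI conjI allI impI)
  \<comment> \<open>The witness is the class of \<open>1/(k + 1)\<close>: positive at each index and
    tending to 0.\<close>
  have "eventually (\<lambda>k. 0 < inverse (real (Suc k))) F"
    by simp
  then show "\<zero>\<^bsub>HR\<^esub> \<prec>\<^bsub>HR\<^esub> hyp (\<lambda>k. inverse (real (Suc k)))"
    by (simp add: zero_hyp lt_hyp)
  fix n :: nat assume n: "n \<ge> 1"
  have "eventually (\<lambda>k. inverse (real (Suc k)) < 1 / real n) sequentially"
    using order_tendstoD(2)[OF LIMSEQ_inverse_real_of_nat] n by simp
  then show "hyp (\<lambda>k. inverse (real (Suc k))) \<prec>\<^bsub>HR\<^esub> \<one>\<^bsub>HR\<^esub> \<oslash>\<^bsub>HR\<^esub> ([n] \<cdot>\<^bsub>HR\<^esub> \<one>\<^bsub>HR\<^esub>)"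
    unfolding nat_elem_hyp unfolding one_hyp
    using n by (simp add: fdiv_hyp lt_hyp eventually_sequentially_imp)
qed (rule hyp_closed)

end

text \<open>Lists of coefficients with the leading coefficient first, as in \<^const>\<open>ring.eval\<close>.\<close>

fun list_poly :: "real list \<Rightarrow> real \<Rightarrow> real"
  where "list_poly [] x = 0"
  | "list_poly (a # as) x = a * x ^ length as + list_poly as x"

section \<open>Real polynomials of odd degree\<close>

lemma continuous_list_poly: "continuous_on A (list_poly as)"
  by (induction as) (auto intro!: continuous_intros)

text \<open>A list of length \<open>m\<close> gives a polynomial of degree below \<open>m\<close>.
  The general filter covers both \<open>at_top\<close> and \<open>at_bot\<close>.\<close>

lemma list_poly_asymp:
  assumes F: "filterlim (\<lambda>x::real. x) at_infinity F"
  shows "((\<lambda>x. list_poly as x / x ^ length as) \<longlongrightarrow> 0) F"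
proof (induction as)
  case (Cons a as)
  have nz: "eventually (\<lambda>x. x \<noteq> 0) F"
    using F by (rule filterlim_at_infinity_imp_eventually_ne)
  have inv: "((\<lambda>x. inverse x) \<longlongrightarrow> 0) F"
    using F tendsto_inverse_0 filterlim_compose by blast
  have "((\<lambda>x. (a + list_poly as x / x ^ length as) * inverse x) \<longlongrightarrow> (a + 0) * 0) F"
    by (intro tendsto_intros Cons inv)
  moreover have "eventually (\<lambda>x. (a + list_poly as x / x ^ length as) * inverse x =
      list_poly (a # as) x / x ^ length (a # as)) F"
    using nz by eventually_elim (simp add: field_simps)
  ultimately show ?case
    using tendsto_cong by fastforce
qed simp

text \<open>Divided by its leading coefficient, the polynomial has the sign of
  \<open>x ^ length as\<close> near both infinities. The odd exponent forces a change of sign, and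
  the intermediate value theorem applies.\<close>

lemma list_poly_odd_root:
  assumes a: "a \<noteq> 0" and "odd (length as)"
  shows "\<exists>x. list_poly (a # as) x = 0"
proof -
  define h where "h x = list_poly (a # as) x / a" for x
  have ev: "eventually (\<lambda>x. h x / x ^ length as > 0) F"
    if F: "filterlim (\<lambda>x::real. x) at_infinity F" for F
  proof -
    have nz: "eventually (\<lambda>x. x \<noteq> 0) F"
      using F by (rule filterlim_at_infinity_imp_eventually_ne)
    have "((\<lambda>x. 1 + list_poly as x / x ^ length as / a) \<longlongrightarrow> 1 + 0 / a) F"
      by (intro tendsto_intros list_poly_asymp[OF F] a)
    then have "eventually (\<lambda>x. 1 + list_poly as x / x ^ length as / a > 0) F"
      by (rule order_tendstoD) simp
    with nz show ?thesis
      by eventually_elim (use a in \<open>simp add: h_def field_simps\<close>)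
  qed
  have "eventually (\<lambda>x. h x / x ^ length as > 0 \<and> x > 0) at_top"
    using ev[OF filterlim_at_top_imp_at_infinity[OF filterlim_ident]]
    by (intro eventually_conj eventually_gt_at_top)
  then obtain u where u: "h u / u ^ length as > 0" "u > 0"
    by (auto simp: eventually_at_top_linorder)
  have "eventually (\<lambda>x. h x / x ^ length as > 0 \<and> x < 0) at_bot"
    using ev[of at_bot] at_bot_le_at_infinity
    by (intro eventually_conj eventually_gt_at_bot) (simp add: filterlim_def)
  then obtain v where v: "h v / v ^ length as > 0" "v < 0"
    by (auto simp: eventually_at_bot_linorder)
  have "u ^ length as > 0" "v ^ length as < 0"
    using u v assms(2) by (auto simp: power_less_zero_eq)
  then have "h u > 0" "h v < 0"
    using u v by (metis zero_less_divide_iff order_less_asym)+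
  moreover have "continuous_on {v..u} h"
    unfolding h_def using a by (intro continuous_on_divide continuous_list_poly continuous_on_const) simp
  ultimately obtain x where "h x = 0"
    using IVT'[of h v 0 u] u v by auto
  then show ?thesis
    using a by (auto simp: h_def)
qed

context nonprincipal_ultrafilter
begin

section \<open>Real closedness of the ultrapower\<close>

lemma eval_hyp:
  "HR.eval (map hyp fs) (hyp s) = hyp (\<lambda>n. list_poly (map (\<lambda>f. f n) fs) (s n))"
  by (induction fs) (simp_all add: hyp_simps pow_hyp)

text \<open>Square roots and roots of polynomials are taken in the reals at each index and assembled
  into a sequence.\<close>

lemma real_closed_hyperreals: "real_closed_field HR"
  unfolding real_closed_field_def
proof (intro conjI ballI impI)
  show "ordered_field HR" by (rule ordered_field_hyperreals)
next
  fix u assume "u \<in> carrier HR" "\<zero>\<^bsub>HR\<^esub> \<prec>\<^bsub>HR\<^esub> u"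
  then obtain f where f: "u = hyp f" "eventually (\<lambda>n. 0 < f n) F"
    by (auto elim!: carrierE simp: hyp_simps)
  then have "hyp (\<lambda>n. sqrt (f n)) \<otimes>\<^bsub>HR\<^esub> hyp (\<lambda>n. sqrt (f n)) = u"
    by (auto simp: mult_hyp hyp_eq_iff elim: eventually_mono)
  then show "\<exists>S\<in>carrier HR. S \<otimes>\<^bsub>HR\<^esub> S = u"
    using hyp_closed by blast
next
  fix p assume p: "p \<in> carrier (univ_poly HR (carrier HR))" and odd: "odd (degree p)"
  \<comment> \<open>\<open>degree p\<close> is \<open>length p - 1\<close>, so the list behind the
    leading coefficient has odd length.\<close>
  from odd obtain u us where us: "p = u # us" "odd (length us)"
    by (cases p) auto
  with p have car: "set p \<subseteq> carrier HR" "u \<noteq> \<zero>\<^bsub>HR\<^esub>"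
    by (auto simp: polynomial_def simp flip: univ_poly_carrier)
  then have "p \<in> lists (range hyp)"
    by (auto simp: hyperreals_def)
  then obtain gs where "p = map hyp gs"
    by (auto simp: lists_image)
  with us obtain f fs where p_eq: "p = map hyp (f # fs)" "u = hyp f" "odd (length fs)"
    by (cases gs) auto
  let ?c = "\<lambda>n. map (\<lambda>f. f n) (f # fs)"
  \<comment> \<open>No root is claimed at indices where the leading coefficient vanishes; its class
    is nonzero, so these indices are negligible for \<open>F\<close>.\<close>
  have "\<exists>s. \<forall>n. f n \<noteq> 0 \<longrightarrow> list_poly (?c n) (s n) = 0"
    using list_poly_odd_root[of "f _" "map (\<lambda>f. f _) fs"] p_eq(3)
    by (intro choice) auto
  then obtain s where s: "\<And>n. f n \<noteq> 0 \<Longrightarrow> list_poly (?c n) (s n) = 0"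
    by blast
  have "eventually (\<lambda>n. f n \<noteq> 0) F"
    using car(2) by (simp add: p_eq hyp_nonzero)
  then have "eventually (\<lambda>n. list_poly (?c n) (s n) = 0) F"
    by (rule eventually_mono) (rule s)
  then have "HR.eval p (hyp s) = \<zero>\<^bsub>HR\<^esub>"
    unfolding p_eq eval_hyp zero_hyp hyp_eq_iff .
  then show "\<exists>S\<in>carrier HR. HR.eval p S = \<zero>\<^bsub>HR\<^esub>"
    using hyp_closed by blast
qed

end

section \<open>Construction of the weighted graph\<close>

lemma reach_trans: "\<lbrakk>(x, y) \<in> reach V \<pi>; (y, z) \<in> reach V \<pi>\<rbrakk> \<Longrightarrow> (x, z) \<in> reach V \<pi>"
  and reach_refl: "(x, x) \<in> reach V \<pi>"
  and reach_step: "\<lbrakk>x \<in> V; y \<in> V; \<pi> x y \<noteq> 0\<rbrakk> \<Longrightarrow> (x, y) \<in> reach V \<pi>"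
  by (auto simp: reach_def)

text \<open>Any countable preorder has a real-valued height: weigh each point \<open>i\<close> below \<open>x\<close> by \<open>2\<^sup>-\<^sup>i\<close>.\<close>

lemma ex_height:
  assumes "countable V"
  shows "\<exists>h :: 'v \<Rightarrow> real. (\<forall>x. 0 \<le> h x) \<and>
    (\<forall>x\<in>V. \<forall>y\<in>V. (x, y) \<in> reach V \<pi> \<longrightarrow>
      (if (y, x) \<in> reach V \<pi> then h x = h y else h x < h y))"
proof -
  define A where "A x = to_nat_on V ` {z \<in> V. (z, x) \<in> reach V \<pi>}" for x
  define d where "d x i = (if i \<in> A x then (1/2)^i else 0 :: real)" for x i
  have d: "0 \<le> d x i" for x i
    by (simp add: d_def)
  have sd: "summable (d x)" for x
    by (rule summable_comparison_test'[OF summable_geometric[of "1/2 :: real"], of 0])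
      (auto simp: d_def)
  have sub: "A x \<subseteq> A y" if "(x, y) \<in> reach V \<pi>" for x y
    using reach_trans[OF _ that] by (auto simp: A_def)
  have less: "suminf (d x) < suminf (d y)"
    if xy: "y \<in> V" "(x, y) \<in> reach V \<pi>" "(y, x) \<notin> reach V \<pi>" for x y
  proof -
    let ?i = "to_nat_on V y"
    \<comment> \<open>The point \<open>y\<close> counts towards the height of \<open>y\<close> but
      not of \<open>x\<close>; as \<open>to_nat_on V\<close> is injective, no other point has its
      index.\<close>
    have "?i \<in> A y" "?i \<notin> A x"
      using xy reach_refl[of y V \<pi>] to_nat_on_inj[OF assms] by (auto simp: A_def)
    then have "0 < d y ?i - d x ?i"
      by (simp add: d_def)
    moreover have "0 \<le> d y i - d x i" for i
      using sub[OF xy(2)] by (auto simp: d_def)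
    ultimately have "0 < (\<Sum>i. d y i - d x i)"
      by (intro suminf_pos2 summable_diff sd)
    then show ?thesis
      by (simp add: suminf_diff[symmetric] sd)
  qed
  have eq: "d x = d y" if "(x, y) \<in> reach V \<pi>" "(y, x) \<in> reach V \<pi>" for x y
    using sub[OF that(1)] sub[OF that(2)] by (auto simp: d_def fun_eq_iff)
  show ?thesis
  proof (intro exI conjI allI ballI impI)
    show "0 \<le> suminf (d x)" for x
      by (intro suminf_nonneg sd d)
    show "if (y, x) \<in> reach V \<pi> then suminf (d x) = suminf (d y) else suminf (d x) < suminf (d y)"
      if "y \<in> V" "(x, y) \<in> reach V \<pi>" for x y
      using less[OF that] eq[OF that(2)] by simp
  qed
qed

text \<open>A finite \<open>V\<close> is mapped onto \<open>{..<card V}\<close> and an infinite one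
  onto all naturals, so the enumeration has no gaps. This keeps the chain of connecting edges
  unbroken.\<close>

lemma to_nat_on_downward_closed:
  assumes "countable V" "x \<in> V" "i \<le> to_nat_on V x"
  shows "\<exists>z\<in>V. to_nat_on V z = i"
proof (cases "finite V")
  case True
  have img: "to_nat_on V ` V = {..<card V}"
    using to_nat_on_finite[OF True] by (simp add: bij_betw_def)
  have "to_nat_on V x \<in> {..<card V}"
    using assms(2) by (simp flip: img)
  with assms(3) have "i \<in> to_nat_on V ` V"
    by (simp add: img)
  then show ?thesis by blast
next
  case False
  then show ?thesis using to_nat_on_surj assms by blast
qed

text \<open>With \<open>h\<close> nonnegative, the connecting edges of weight \<open>1/N\<close> are
  negligible against every \<open>N powr h x\<close>.\<close>

locale balanced_matrix = nonprincipal_ultrafilter F for F +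
  fixes V :: "'v set" and \<pi> :: "'v \<Rightarrow> 'v \<Rightarrow> real" and \<beta> h :: "'v \<Rightarrow> real"
  assumes countable: "countable V"
    and transition: "transition_matrix V \<pi>"
    and out_finite: "locally_finite_matrix V \<pi>"
    and in_finite: "finite_in_degree V \<pi>"
    and balanced: "balanced_on_classes V \<pi> \<beta>"
    and diag: "\<lbrakk>x \<in> V; \<not> absorbing V \<pi> x\<rbrakk> \<Longrightarrow> \<pi> x x = 0"
    and h_nonneg: "0 \<le> h x"
    and height: "\<lbrakk>x \<in> V; y \<in> V; (x, y) \<in> reach V \<pi>\<rbrakk> \<Longrightarrow>
      if (y, x) \<in> reach V \<pi> then h x = h y else h x < h y"
begin

lemma \<pi>_nonneg: "\<lbrakk>x \<in> V; y \<in> V\<rbrakk> \<Longrightarrow> 0 \<le> \<pi> x y"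
  using transition by (auto simp: transition_matrix_def)

lemma \<beta>_pos: "x \<in> V \<Longrightarrow> 0 < \<beta> x"
  using balanced by (auto simp: balanced_on_classes_def)

lemma \<beta>_balance:
  assumes "x \<in> V" "y \<in> V" "(x, y) \<in> reach V \<pi>" "(y, x) \<in> reach V \<pi>"
  shows "\<pi> x y * \<beta> x = \<pi> y x * \<beta> y"
proof -
  have "communicates V \<pi> `` {x} \<in> irreducible_classes V \<pi>"
    using assms by (auto simp: irreducible_classes_def intro: quotientI)
  moreover have "x \<in> communicates V \<pi> `` {x}" "y \<in> communicates V \<pi> `` {x}"
    using assms reach_refl by (auto simp: communicates_def)
  ultimately show ?thesis
    using balanced unfolding balanced_on_classes_def by blast
qed

section \<open>The weights and the graph\<close>

text \<open>The base \<open>Suc n\<close> keeps the power positive at every index, whereas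
  \<open>0 powr s\<close> is 0.\<close>

definition flow :: "nat \<Rightarrow> 'v \<Rightarrow> 'v \<Rightarrow> real"
  where "flow n x y = \<pi> x y * \<beta> x * real (Suc n) powr h x"

definition chained :: "'v \<Rightarrow> 'v \<Rightarrow> bool"
  where "chained x y \<longleftrightarrow>
    to_nat_on V y = Suc (to_nat_on V x) \<or> to_nat_on V x = Suc (to_nat_on V y)"

text \<open>Inside a class both flows agree, and the maximum counts them once. A sum would double
  these edges against those leading to other classes.\<close>

definition bseq :: "'v \<Rightarrow> 'v \<Rightarrow> nat \<Rightarrow> real"
  where "bseq x y n = (if x = y then 0 else
    max (max (flow n x y) (flow n y x)) (if chained x y then inverse (real (Suc n)) else 0))"

text \<open>The support of \<open>bseq x\<close>, the same at all indices, so that vertex weights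
  are sums over a fixed finite set.\<close>

definition nbrs :: "'v \<Rightarrow> 'v set"
  where "nbrs x = {y \<in> V. x \<noteq> y \<and> (\<pi> x y \<noteq> 0 \<or> \<pi> y x \<noteq> 0 \<or> chained x y)}"

lemma flow_pos_iff: "\<lbrakk>x \<in> V; y \<in> V\<rbrakk> \<Longrightarrow> 0 < flow n x y \<longleftrightarrow> \<pi> x y \<noteq> 0"
  using \<pi>_nonneg[of x y] \<beta>_pos[of x] by (auto simp: flow_def zero_less_mult_iff)

lemma bseq_sym: "bseq x y = bseq y x"
  by (auto simp: fun_eq_iff bseq_def chained_def)

lemma bseq_pos: "\<lbrakk>x \<in> V; y \<in> nbrs x\<rbrakk> \<Longrightarrow> 0 < bseq x y n"
  using flow_pos_iff[of x y n] flow_pos_iff[of y x n]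
  by (auto simp: nbrs_def bseq_def less_max_iff_disj)

lemma bseq_zero: "\<lbrakk>x \<in> V; y \<in> V; y \<notin> nbrs x\<rbrakk> \<Longrightarrow> bseq x y n = 0"
  by (auto simp: nbrs_def bseq_def flow_def)

text \<open>The in-degree enters because every transition into \<open>x\<close> also creates an edge
  at \<open>x\<close>.\<close>

lemma finite_nbrs:
  assumes "x \<in> V" shows "finite (nbrs x)"
proof -
  have "finite {y \<in> V. chained x y}"
  proof (rule inj_on_finite)
    show "inj_on (to_nat_on V) {y \<in> V. chained x y}"
      using countable by (auto intro: inj_on_subset)
    show "to_nat_on V ` {y \<in> V. chained x y} \<subseteq> {..Suc (to_nat_on V x)}"
      by (auto simp: chained_def)
  qed simp
  moreover have "finite {y \<in> V. \<pi> x y \<noteq> 0}" "finite {y \<in> V. \<pi> y x \<noteq> 0}"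
    using assms out_finite in_finite
    by (auto simp: locally_finite_matrix_def finite_in_degree_def)
  ultimately have "finite ({y \<in> V. chained x y} \<union> {y \<in> V. \<pi> x y \<noteq> 0} \<union> {y \<in> V. \<pi> y x \<noteq> 0})"
    by blast
  then show ?thesis
    by (rule rev_finite_subset) (auto simp: nbrs_def)
qed

definition b :: "'v \<Rightarrow> 'v \<Rightarrow> (nat \<Rightarrow> real) set"
  where "b x y = hyp (bseq x y)"

lemma b_pos: "\<lbrakk>x \<in> V; y \<in> nbrs x\<rbrakk> \<Longrightarrow> \<zero>\<^bsub>HR\<^esub> \<prec>\<^bsub>HR\<^esub> b x y"
  by (simp add: b_def zero_hyp lt_hyp bseq_pos)

lemma b_zero: "\<lbrakk>x \<in> V; y \<in> V; y \<notin> nbrs x\<rbrakk> \<Longrightarrow> b x y = \<zero>\<^bsub>HR\<^esub>"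
  by (simp add: b_def zero_hyp bseq_zero fun_eq_iff hyp_eq_iff)

lemma b_nonzero: "\<lbrakk>x \<in> V; y \<in> nbrs x\<rbrakk> \<Longrightarrow> b x y \<noteq> \<zero>\<^bsub>HR\<^esub>"
  using b_pos[of x y] HR.lt_irrefl[of "\<zero>\<^bsub>HR\<^esub>"] by auto

lemma nbrs_subset: "nbrs x \<subseteq> V"
  by (auto simp: nbrs_def)

lemma weighted_graph_b: "weighted_graph HR V b"
  unfolding weighted_graph_def nonneg_def
proof (intro conjI ballI)
  fix x y assume "x \<in> V" "y \<in> V"
  then show "b x y = \<zero>\<^bsub>HR\<^esub> \<or> \<zero>\<^bsub>HR\<^esub> \<prec>\<^bsub>HR\<^esub> b x y"
    using b_pos b_zero by blast
  show "b x y \<in> carrier HR" "b x y = b y x"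
    by (simp_all add: b_def hyp_closed bseq_sym)
  show "b x x = \<zero>\<^bsub>HR\<^esub>"
    using \<open>x \<in> V\<close> by (intro b_zero) (auto simp: nbrs_def)
qed

lemma adjacency_b: "adjacency HR V b = {(x, y). x \<in> V \<and> y \<in> nbrs x}"
  using b_pos b_zero HR.lt_irrefl by (fastforce simp: adjacency_def nbrs_def)

lemma locally_finite_graph_b: "locally_finite_graph HR V b"
  unfolding locally_finite_graph_def
proof
  fix x assume "x \<in> V"
  then have "finite (nbrs x)" by (rule finite_nbrs)
  then show "finite {y. (y, x) \<in> adjacency HR V b}"
    by (rule rev_finite_subset) (auto simp: adjacency_b nbrs_def chained_def)
qed

lemma connected_graph_b: "connected_graph HR V b"
proof -
  let ?A = "adjacency HR V b"
  have "sym ?A"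
    by (auto simp: sym_def adjacency_b nbrs_def chained_def)
  then have sym: "sym (?A\<^sup>*)"
    by (rule sym_rtrancl)
  \<comment> \<open>From \<open>x\<close> one chained edge after the other leads down the
    enumeration to \<open>y\<close>; symmetry covers the upward direction.\<close>
  have down: "to_nat_on V x = k \<Longrightarrow> x \<in> V \<Longrightarrow> y \<in> V \<Longrightarrow> to_nat_on V y \<le> k \<Longrightarrow> (x, y) \<in> ?A\<^sup>*"
    for k x y
  proof (induction k arbitrary: x)
    case 0
    then have "x = y" using to_nat_on_inj[OF countable, of x y] by simp
    then show ?case by simp
  next
    case (Suc k)
    show ?case
    proof (cases "to_nat_on V y = Suc k")
      case True
      then have "x = y" using Suc.prems to_nat_on_inj[OF countable, of x y] by simp
      then show ?thesis by simp
    next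
      case False
      obtain z where z: "z \<in> V" "to_nat_on V z = k"
        using to_nat_on_downward_closed[OF countable \<open>x \<in> V\<close>, of k] Suc.prems by auto
      then have "(x, z) \<in> ?A"
        using Suc.prems by (auto simp: adjacency_b nbrs_def chained_def)
      moreover have "(z, y) \<in> ?A\<^sup>*"
        using z Suc.prems False by (intro Suc.IH) auto
      ultimately show ?thesis by (rule converse_rtrancl_into_rtrancl)
    qed
  qed
  show ?thesis
    unfolding connected_graph_def
  proof (intro ballI)
    fix x y assume "x \<in> V" "y \<in> V"
    then show "(x, y) \<in> ?A\<^sup>*"
      using down[of x _ y] down[of y _ x] sym
      by (cases "to_nat_on V x \<le> to_nat_on V y") (auto dest: symD)
  qed
qed

section \<open>Limits of the rescaled weights\<close>

lemma tendsto_powr_neg: "s < 0 \<Longrightarrow> (\<lambda>n. real (Suc n) powr s) \<longlonglongrightarrow> 0"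
  by (intro tendsto_neg_powr filterlim_compose[OF filterlim_real_sequentially filterlim_Suc])

text \<open>At the scale of \<open>x\<close>, the flow from \<open>y\<close> equals the flow to
  \<open>y\<close> if the two communicate, by balance and equal heights. If only \<open>y\<close>
  reaches \<open>x\<close>, then \<open>y\<close> is lower and its flow tends to 0. So the outgoing
  flow decides the maximum in \<open>bseq\<close>.\<close>

lemma backflow_limit:
  assumes x: "x \<in> V" and y: "y \<in> V"
  shows "\<exists>l \<le> \<pi> x y * \<beta> x. (\<lambda>n. flow n y x / real (Suc n) powr h x) \<longlonglongrightarrow> l"
proof (cases "\<pi> y x = 0")
  case True
  then show ?thesis
    using \<pi>_nonneg[OF x y] \<beta>_pos[OF x] by (auto simp: flow_def intro!: exI[of _ 0])
next
  case False
  then have yx: "(y, x) \<in> reach V \<pi>"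
    using reach_step x y by metis
  show ?thesis
  proof (cases "(x, y) \<in> reach V \<pi>")
    case True
    then have "\<pi> y x * \<beta> y = \<pi> x y * \<beta> x" "h y = h x"
      using \<beta>_balance[OF y x yx] height[OF y x yx] by auto
    then show ?thesis
      by (auto simp: flow_def)
  next
    case False
    then have "h y - h x < 0"
      using height[OF y x yx] by simp
    then have "(\<lambda>n. \<pi> y x * \<beta> y * real (Suc n) powr (h y - h x)) \<longlonglongrightarrow> \<pi> y x * \<beta> y * 0"
      by (intro tendsto_intros tendsto_powr_neg)
    then have "(\<lambda>n. flow n y x / real (Suc n) powr h x) \<longlonglongrightarrow> 0"
      by (simp add: flow_def powr_diff)
    then show ?thesis
      using \<pi>_nonneg[OF x y] \<beta>_pos[OF x] by (auto intro!: exI[of _ 0])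
  qed
qed

lemma bseq_limit:
  assumes x: "x \<in> V" "\<not> absorbing V \<pi> x" and y: "y \<in> V"
  shows "(\<lambda>n. bseq x y n / real (Suc n) powr h x) \<longlonglongrightarrow> \<pi> x y * \<beta> x"
proof (cases "x = y")
  case True
  \<comment> \<open>The weight is 0 on the diagonal, so this case is the vanishing of
    \<open>\<pi> x x\<close>.\<close>
  then show ?thesis using diag[OF x] by (simp add: bseq_def)
next
  case False
  let ?N = "\<lambda>n. real (Suc n)"
  let ?e = "\<lambda>n. if chained x y then ?N n powr (- 1 - h x) else 0"
  obtain l where l: "l \<le> \<pi> x y * \<beta> x" "(\<lambda>n. flow n y x / ?N n powr h x) \<longlonglongrightarrow> l"
    using backflow_limit[OF x(1) y] by blast
  have "?e \<longlonglongrightarrow> 0"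
    using tendsto_powr_neg[of "- 1 - h x"] h_nonneg[of x] by (cases "chained x y") simp_all
  then have "(\<lambda>n. max (max (\<pi> x y * \<beta> x) (flow n y x / ?N n powr h x)) (?e n)) \<longlonglongrightarrow>
      max (max (\<pi> x y * \<beta> x) l) 0"
    by (intro tendsto_max tendsto_const l)
  moreover have "max (max (\<pi> x y * \<beta> x) l) 0 = \<pi> x y * \<beta> x"
    using l(1) mult_nonneg_nonneg[OF \<pi>_nonneg[OF x(1) y] less_imp_le[OF \<beta>_pos[OF x(1)]]]
    by (simp only: max_absorb1)
  moreover have "bseq x y n / ?N n powr h x =
      max (max (\<pi> x y * \<beta> x) (flow n y x / ?N n powr h x)) (?e n)" for n
  proof -
    have "max s t / ?N n powr h x = max (s / ?N n powr h x) (t / ?N n powr h x)" for s t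
      by (simp add: max_divide_distrib_right)
    moreover have "flow n x y / ?N n powr h x = \<pi> x y * \<beta> x"
      by (simp add: flow_def)
    moreover have "(if chained x y then inverse (?N n) else 0) / ?N n powr h x = ?e n"
      by (simp add: powr_diff powr_minus)
    ultimately show ?thesis
      using False by (simp only: bseq_def if_False)
  qed
  ultimately show ?thesis by simp
qed

lemma vweight_b: "x \<in> V \<Longrightarrow> vweight HR V b x = hyp (\<lambda>n. \<Sum>y\<in>nbrs x. bseq x y n)"
proof -
  assume x: "x \<in> V"
  have "{y \<in> V. b x y \<noteq> \<zero>\<^bsub>HR\<^esub>} = nbrs x"
    using b_zero[OF x] b_nonzero[OF x] nbrs_subset[of x] by blast
  then show ?thesis
    using finsum_hyp[OF finite_nbrs[OF x], of "bseq x"] by (simp add: vweight_def b_def[abs_def])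
qed

text \<open>The other entries of the row vanish, since \<open>x\<close> reaches only itself, and the
  row sums to 1.\<close>

lemma absorbingD:
  assumes "x \<in> V" "absorbing V \<pi> x" "y \<in> V"
  shows "\<pi> x y = (if x = y then 1 else 0)"
proof -
  have off: "\<pi> x y = 0" if "y \<in> V" "x \<noteq> y" for y
    using reach_step assms that by (metis absorbing_def)
  have "(\<pi> x has_sum 1) V"
    using transition assms by (auto simp: transition_matrix_def)
  moreover have "(\<pi> x has_sum 1) V \<longleftrightarrow> (\<pi> x has_sum 1) {x}"
    using off assms by (intro has_sum_cong_neutral) auto
  ultimately have "\<pi> x x = 1"
    using has_sum_finite[of "{x}" "\<pi> x"] by (auto dest: has_sum_unique)
  with off assms show ?thesis by auto
qed

text \<open>As \<open>\<pi> x x = 0\<close>, the row is supported in \<open>nbrs x\<close>, and its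
  infinite sum becomes a finite one.\<close>

lemma sum_nbrs:
  assumes x: "x \<in> V" "\<not> absorbing V \<pi> x"
  shows "(\<Sum>y\<in>nbrs x. \<pi> x y) = 1"
proof -
  have "(\<pi> x has_sum 1) V"
    using transition assms by (auto simp: transition_matrix_def)
  moreover have "(\<pi> x has_sum 1) V \<longleftrightarrow> (\<pi> x has_sum 1) (nbrs x)"
    using diag[OF x] by (intro has_sum_cong_neutral) (auto simp: nbrs_def)
  ultimately show ?thesis
    using has_sum_finite[OF finite_nbrs[OF x(1)], of "\<pi> x"] by (auto dest: has_sum_unique)
qed

text \<open>Divided by \<open>N powr h x\<close>, the edge weight tends to
  \<open>\<pi> x y * \<beta> x\<close> and the vertex weight to \<open>\<beta> x\<close>, because
  the row sums to 1. The scale cancels in the quotient.\<close>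

lemma real_part_trans_prob_b:
  assumes x: "x \<in> V" "\<not> absorbing V \<pi> x" and y: "y \<in> V"
  shows "real_part HR (trans_prob HR V b x y) = \<pi> x y"
proof -
  let ?N = "\<lambda>n. real (Suc n) powr h x"
  let ?w = "\<lambda>n. \<Sum>y\<in>nbrs x. bseq x y n"
  \<comment> \<open>An empty neighbourhood would have row sum 0. Hence the vertex weight is positive
    at every index, as the division requires.\<close>
  have "nbrs x \<noteq> {}"
    using sum_nbrs[OF x] by auto
  then have w: "0 < ?w n" for n
    using bseq_pos[OF x(1)] by (intro sum_pos finite_nbrs x) auto
  have "(\<lambda>n. \<Sum>y\<in>nbrs x. bseq x y n / ?N n) \<longlonglongrightarrow> (\<Sum>y\<in>nbrs x. \<pi> x y * \<beta> x)"
    by (intro tendsto_sum bseq_limit x) (auto simp: nbrs_def)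
  then have "(\<lambda>n. ?w n / ?N n) \<longlonglongrightarrow> \<beta> x"
    using sum_nbrs[OF x] by (simp add: sum_divide_distrib flip: sum_distrib_right)
  then have "(\<lambda>n. (bseq x y n / ?N n) / (?w n / ?N n)) \<longlonglongrightarrow> \<pi> x y * \<beta> x / \<beta> x"
    using \<beta>_pos[OF x(1)] by (intro tendsto_divide bseq_limit x y) auto
  then have "(\<lambda>n. bseq x y n / ?w n) \<longlonglongrightarrow> \<pi> x y"
    using \<beta>_pos[OF x(1)] by simp
  moreover have "trans_prob HR V b x y = hyp (\<lambda>n. bseq x y n / ?w n)"
    unfolding trans_prob_def vweight_b[OF x(1)] b_def
    using w by (intro fdiv_hyp) (simp add: less_imp_neq[symmetric])
  ultimately show ?thesis
    by (simp add: real_part_hyp)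
qed

text \<open>Absorbing states stay outside \<open>U\<close>, where the real matrix has identity rows
  whatever edges connect them to the graph.\<close>

lemma represents_b: "represents HR V {x \<in> V. \<not> absorbing V \<pi> x} b \<pi>"
proof -
  have "\<pi> x y = real_matrix HR V {x \<in> V. \<not> absorbing V \<pi> x} b x y" if "x \<in> V" "y \<in> V" for x y
    using that by (cases "absorbing V \<pi> x")
      (simp_all add: real_matrix_def real_part_trans_prob_b absorbingD)
  then show ?thesis
    using real_closed_hyperreals non_archimedean_hyperreals weighted_graph_b connected_graph_b
      locally_finite_graph_b by (simp add: represents_def)
qed

end

lemma ex_representation:
  fixes V :: "'v set" and \<pi> :: "'v \<Rightarrow> 'v \<Rightarrow> real"
  assumes "countable V" "transition_matrix V \<pi>" "locally_finite_matrix V \<pi>" "finite_in_degree V \<pi>"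
    and "balanced_on_classes V \<pi> \<beta>" "\<forall>x\<in>V. \<not> absorbing V \<pi> x \<longrightarrow> \<pi> x x = 0"
  shows "\<exists>(K :: (nat \<Rightarrow> real) set ordered_ring) b U. represents K V U b \<pi>"
proof -
  obtain F :: "nat filter" where F: "F \<le> sequentially" "F \<noteq> bot"
    "\<forall>P. eventually P F \<or> eventually (\<lambda>x. \<not> P x) F"
    using ex_ultrafilter[OF sequentially_bot] by blast
  obtain h :: "'v \<Rightarrow> real" where h: "\<forall>x. 0 \<le> h x" "\<forall>x\<in>V. \<forall>y\<in>V. (x, y) \<in> reach V \<pi> \<longrightarrow>
      (if (y, x) \<in> reach V \<pi> then h x = h y else h x < h y)"
    using ex_height[OF assms(1)] by blast
  interpret balanced_matrix F V \<pi> \<beta> h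
    using assms F h by unfold_locales blast+
  show ?thesis
    using represents_b by blast
qed

text \<open>Existence is stated for one concrete carrier type, that of the ultrapower; necessity,
  with the normalised \<open>\<beta>\<close>, ranges over fields of any type
  \<open>'k\<close>.\<close>

theorem theorem3p22:
  fixes V :: "'v set" and \<pi> :: "'v \<Rightarrow> 'v \<Rightarrow> real"
  assumes "countable V"
    and "transition_matrix V \<pi>"
    and "locally_finite_matrix V \<pi>"
  shows "(finite_in_degree V \<pi> \<longrightarrow>
      ((\<exists>(K :: (nat \<Rightarrow> real) set ordered_ring) b U. represents K V U b \<pi>) \<longleftrightarrow>
       (\<exists>\<beta>. balanced_on_classes V \<pi> \<beta>) \<and> (\<forall>x\<in>V. \<not> absorbing V \<pi> x \<longrightarrow> \<pi> x x = 0)))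
    \<and> (\<forall>(K :: 'k ordered_ring) b U. represents K V U b \<pi> \<longrightarrow>
        (\<exists>\<beta>. balanced_on_classes V \<pi> \<beta> \<and> normalised_by_weights K V b \<pi> \<beta>) \<and>
        (\<forall>x\<in>V. \<not> absorbing V \<pi> x \<longrightarrow> \<pi> x x = 0))"
proof (intro conjI impI iffI allI)
  assume "\<exists>(K :: (nat \<Rightarrow> real) set ordered_ring) b U. represents K V U b \<pi>"
  then show "\<exists>\<beta>. balanced_on_classes V \<pi> \<beta>" "\<forall>x\<in>V. \<not> absorbing V \<pi> x \<longrightarrow> \<pi> x x = 0"
    using represents_imp[OF assms(2)] by blast+
next
  assume "finite_in_degree V \<pi>"
    and "(\<exists>\<beta>. balanced_on_classes V \<pi> \<beta>) \<and> (\<forall>x\<in>V. \<not> absorbing V \<pi> x \<longrightarrow> \<pi> x x = 0)"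
  then show "\<exists>(K :: (nat \<Rightarrow> real) set ordered_ring) b U. represents K V U b \<pi>"
    using ex_representation[OF assms] by blast
next
  fix K :: "'k ordered_ring" and b U
  assume "represents K V U b \<pi>"
  then show "\<exists>\<beta>. balanced_on_classes V \<pi> \<beta> \<and> normalised_by_weights K V b \<pi> \<beta>"
    and "\<forall>x\<in>V. \<not> absorbing V \<pi> x \<longrightarrow> \<pi> x x = 0"
    using represents_imp[OF assms(2)] by blast+
qed

end
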